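(* Let $G$ be any countably infinite group. Then there is a free minimal $G$-flow $X$ which does not admit a characteristic measure. More precisely, there is a free $(G\times F_2)$-flow $X$ which is minimal as a $G$-flow and which has no $F_2$-invariant measure.
   Context: $F_2$ is the free group on two generators; $G$ and $F_2$ are identified with the subgroups $G\times\{1\}$ and $\{1\}\times F_2$ of $G\times F_2$. For a countable group $\Gamma$, a $\Gamma$-flow is a non-empty compact Hausdorff space $X$ with a continuous action of $\Gamma$ (as a discrete group). For a subgroup $\Delta\subseteq\Gamma$, a $\Gamma$-flow is regarded as a $\Delta$-flow by restricting the action, and it is minimal as a $\Delta$-flow if every $\Delta$-orbit is dense. A $\Gamma$-flow $X$ is free if $gx\neq x$ for every $g\in\Gamma\setminus\{1_\Gamma\}$ and every $x\in X$. $\mathrm{Aut}(X,G)$ is the group of homeomorphisms of $X$ which commute with the $G$-action. $P(X)$ is the set of (regular Borel) probability measures on $X$; "measure" means an element of $P(X)$. A measure $\mu\in P(X)$ is characteristic (for the $G$-flow $X$) if it is $\mathrm{Aut}(X,G)$-invariant. *)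

theory Defs
  imports "HOL-Probability.Probability_Measure" "HOL-Algebra.Group_Action"
begin

section \<open>The free group on two generators\<close>

text \<open>
  The two generators are named by the Booleans. A letter (a, s) stands for the generator a if
  s holds and for its inverse otherwise. The elements of the free group are the reduced words;
  the product is concatenation followed by free reduction.
\<close>

type_synonym letter = "bool \<times> bool"

definition inv_letter :: "letter \<Rightarrow> letter" where
  "inv_letter x = (fst x, \<not> snd x)"

fun reduced :: "letter list \<Rightarrow> bool" where
  "reduced [] = True"
| "reduced [x] = True"
| "reduced (x # y # w) = (y \<noteq> inv_letter x \<and> reduced (y # w))"

fun cons_letter :: "letter \<Rightarrow> letter list \<Rightarrow> letter list" where
  "cons_letter x [] = [x]"
| "cons_letter x (y # w) = (if y = inv_letter x then w else x # y # w)"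

definition F2 :: "letter list monoid" where
  "F2 = \<lparr>carrier = {w. reduced w}, mult = foldr cons_letter, one = []\<rparr>"

lemma inv_letter_inv [simp]: "inv_letter (inv_letter x) = x"
  by (simp add: inv_letter_def)

lemma inv_letter_eq_iff [simp]: "inv_letter x = inv_letter y \<longleftrightarrow> x = y"
  by (auto simp: inv_letter_def prod_eq_iff)

lemma reduced_tl: "reduced (x # w) \<Longrightarrow> reduced w"
  by (cases w) auto

lemma cons_letter_reduced [simp]: "reduced (x # w) \<Longrightarrow> cons_letter x w = x # w"
  by (cases w) auto

lemma reduced_cons_letter: "reduced w \<Longrightarrow> reduced (cons_letter x w)"
  by (cases w) (auto dest: reduced_tl)

lemma cons_letter_cancel: "reduced w \<Longrightarrow> cons_letter x (cons_letter (inv_letter x) w) = w"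
  by (cases w) auto

lemma reduced_mult: "reduced v \<Longrightarrow> reduced (foldr cons_letter u v)"
  by (induction u) (auto intro: reduced_cons_letter)

lemma mult_cons_letter:
  assumes "reduced u" "reduced v"
  shows "foldr cons_letter (cons_letter x u) v = cons_letter x (foldr cons_letter u v)"
  using assms cons_letter_cancel[OF reduced_mult, of v x]
  by (cases u) auto

lemma mult_assoc:
  assumes "reduced v" "reduced w"
  shows "foldr cons_letter (foldr cons_letter u v) w = foldr cons_letter u (foldr cons_letter v w)"
  by (induction u) (simp_all add: mult_cons_letter assms reduced_mult)

lemma mult_Nil: "reduced u \<Longrightarrow> foldr cons_letter u [] = u"
proof (induction u)
  case (Cons x u)
  then show ?case using reduced_tl[OF Cons.prems] by simp
qed simp

lemma left_inverse:
  "reduced u \<Longrightarrow> \<exists>v. reduced v \<and> foldr cons_letter v u = []"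
proof (induction u)
  case Nil
  show ?case by (rule exI[of _ "[]"]) simp
next
  case (Cons x u)
  from Cons obtain v where v: "reduced v" "foldr cons_letter v u = []"
    by (auto dest: reduced_tl)
  let ?y = "[inv_letter x]"
  have "foldr cons_letter (foldr cons_letter v ?y) (x # u) = []"
    using Cons.prems v by (subst mult_assoc) auto
  then show ?case by (meson reduced.simps(2) reduced_mult)
qed

lemma group_F2: "group F2"
  by (rule groupI) (auto simp: F2_def reduced_mult mult_assoc left_inverse)


section \<open>Flows\<close>

text \<open>
  A flow is an abstract topology together with an action in the sense of the library,
  so every \<^term>\<open>\<phi> g\<close> is extensional on \<^term>\<open>topspace X\<close>.
\<close>

definition is_flow :: "('g, 'm) monoid_scheme \<Rightarrow> 'x topology \<Rightarrow> ('g \<Rightarrow> 'x \<Rightarrow> 'x) \<Rightarrow> bool" where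
  "is_flow \<Gamma> X \<phi> \<longleftrightarrow>
     topspace X \<noteq> {} \<and> compact_space X \<and> Hausdorff_space X \<and>
     group_action \<Gamma> (topspace X) \<phi> \<and> (\<forall>g\<in>carrier \<Gamma>. continuous_map X X (\<phi> g))"

definition minimal_flow :: "('g, 'm) monoid_scheme \<Rightarrow> 'x topology \<Rightarrow> ('g \<Rightarrow> 'x \<Rightarrow> 'x) \<Rightarrow> bool" where
  "minimal_flow \<Gamma> X \<phi> \<longleftrightarrow>
     is_flow \<Gamma> X \<phi> \<and> (\<forall>x\<in>topspace X. X closure_of (orbit \<Gamma> \<phi> x) = topspace X)"

definition free_flow :: "('g, 'm) monoid_scheme \<Rightarrow> 'x topology \<Rightarrow> ('g \<Rightarrow> 'x \<Rightarrow> 'x) \<Rightarrow> bool" where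
  "free_flow \<Gamma> X \<phi> \<longleftrightarrow>
     is_flow \<Gamma> X \<phi> \<and> (\<forall>g\<in>carrier \<Gamma> - {\<one>\<^bsub>\<Gamma>\<^esub>}. \<forall>x\<in>topspace X. \<phi> g x \<noteq> x)"

text \<open>The restrictions of an action of a direct product to its two factors.\<close>

definition restrict_fst ::
    "('h, 'n) monoid_scheme \<Rightarrow> ('g \<times> 'h \<Rightarrow> 'x \<Rightarrow> 'x) \<Rightarrow> 'g \<Rightarrow> 'x \<Rightarrow> 'x" where
  "restrict_fst H \<phi> = (\<lambda>g. \<phi> (g, \<one>\<^bsub>H\<^esub>))"

definition restrict_snd ::
    "('g, 'm) monoid_scheme \<Rightarrow> ('g \<times> 'h \<Rightarrow> 'x \<Rightarrow> 'x) \<Rightarrow> 'h \<Rightarrow> 'x \<Rightarrow> 'x" where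
  "restrict_snd G \<phi> = (\<lambda>h. \<phi> (\<one>\<^bsub>G\<^esub>, h))"

definition flow_Aut :: "('g, 'm) monoid_scheme \<Rightarrow> 'x topology \<Rightarrow> ('g \<Rightarrow> 'x \<Rightarrow> 'x) \<Rightarrow> ('x \<Rightarrow> 'x) set" where
  "flow_Aut \<Gamma> X \<phi> =
     {f \<in> Bij (topspace X). homeomorphic_map X X f \<and>
        (\<forall>g\<in>carrier \<Gamma>. \<forall>x\<in>topspace X. f (\<phi> g x) = \<phi> g (f x))}"


section \<open>Measures\<close>

text \<open>
  Regular Borel probability measures on an abstract topology. In the Hausdorff case compact
  sets are closed, so all sets occurring in the regularity clauses are Borel.
\<close>

definition prob_measures :: "'x topology \<Rightarrow> 'x measure set" where
  "prob_measures X =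
     {\<mu>. space \<mu> = topspace X \<and> sets \<mu> = sigma_sets (topspace X) {U. openin X U} \<and>
        prob_space \<mu> \<and>
        (\<forall>A\<in>sets \<mu>. emeasure \<mu> A = (INF U\<in>{U. openin X U \<and> A \<subseteq> U}. emeasure \<mu> U)) \<and>
        (\<forall>A\<in>sets \<mu>. emeasure \<mu> A = (SUP K\<in>{K. compactin X K \<and> K \<subseteq> A}. emeasure \<mu> K))}"

definition invariant_measure :: "('x \<Rightarrow> 'x) set \<Rightarrow> 'x measure \<Rightarrow> bool" where
  "invariant_measure S \<mu> \<longleftrightarrow> (\<forall>f\<in>S. distr \<mu> \<mu> f = \<mu>)"

definition characteristic_measure ::
    "('g, 'm) monoid_scheme \<Rightarrow> 'x topology \<Rightarrow> ('g \<Rightarrow> 'x \<Rightarrow> 'x) \<Rightarrow> 'x measure \<Rightarrow> bool" where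
  "characteristic_measure \<Gamma> X \<phi> \<mu> \<longleftrightarrow>
     \<mu> \<in> prob_measures X \<and> invariant_measure (flow_Aut \<Gamma> X \<phi>) \<mu>"

text \<open>
  Existential statements about flows cannot range over all types. The underlying set of the space
  is therefore taken to be a subset of the following type, which has the cardinality of the
  continuum; the topology on it is arbitrary and need not be related to the product topology.
  For actions of countable groups that are free, minimal for a subgroup and without invariant
  measure for another one, this is no restriction: such a flow has a metrizable factor with the
  same properties, and compact metrizable spaces have at most continuum many points.
\<close>

type_synonym point = "nat \<Rightarrow> bool"

end

theory Submission
  imports Defs
begin

text \<open>
  A configuration assigns to every point of \<open>G \<times> F2\<close> countably many letters, its layers, and
  \<open>G \<times> F2\<close> acts by right translation. Layer 0 assigns to every vertex of each copy of the
  tree of \<open>F2\<close> a pointer to a neighbour such that every vertex is pointed to at least twice; an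
  \<open>F2\<close>-invariant measure would contradict mass transport. Layer \<open>j + 1\<close> is a colouring with
  \<open>x (\<gamma> a) \<noteq> x a\<close> for the \<open>j\<close>-th element \<open>\<gamma>\<close> of the group, hence
  \<open>\<gamma>\<close> acts without fixed points.

  Minimality for \<open>G\<close> is forced in stages. Stage \<open>n + 1\<close> consists of the configurations of stage
  \<open>n\<close> in which every \<open>n\<close>-pattern of stage \<open>n\<close> occurs in every \<open>G\<close>-orbit within a bounded
  distance; a compactness argument yields a common point of all stages. That the stages are
  non-empty relies on the possibility to glue configurations of a stage along distant pieces.
  The pointers do not glue along arbitrary sets: in a tree, the points of a large sphere may
  be far apart and together leave too few pointers to the interior of the ball. They do glue along
  sets which are connected at small distances in every copy of the tree, and this property can be
  preserved because the windows of different spots are balls which keep away from each other.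
\<close>

section \<open>The tree of the free group\<close>

text \<open>Neighbours are reached by multiplication on the left while the group acts by
  multiplication on the right, so distances, balls and local rules are invariant under the action.
  Gluing prescribes at each point \<open>a\<close> of a set \<open>A\<close> the value of a whole
  configuration \<open>y a\<close>; nearby points must carry the same configuration, so a rule that
  relates them is inherited from it. No gluing constant serves all layers at once, since the
  elements \<open>elt j\<close> move points arbitrarily far. Stage \<open>n\<close> therefore glues
  only the layers below \<open>n\<close>, leaves the others free apart from their own rule, and each
  step adds one layer at the price of a larger constant. Recurrence along \<open>G\<close>-orbits
  means that a pattern must be found over a prescribed vertex of the tree. Nothing is known about
  \<open>G\<close> beyond its being countably infinite; infinity supplies arbitrarily many candidate
  positions over that vertex, whereas the number of obstructions stays bounded.\<close>

abbreviation fmul :: "letter list \<Rightarrow> letter list \<Rightarrow> letter list" where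
  "fmul \<equiv> foldr cons_letter"

text \<open>Distance at most \<open>r\<close> in the Cayley graph whose edges are left
  multiplications by letters. The word \<open>w\<close> need not be reduced, so steps compose by
  mere concatenation.\<close>

definition near :: "nat \<Rightarrow> letter list \<Rightarrow> letter list \<Rightarrow> bool" where
  "near r u v \<longleftrightarrow> (\<exists>w. length w \<le> r \<and> v = fmul w u)"

lemma near_refl: "near r u u"
  unfolding near_def by (rule exI[of _ "[]"]) simp

lemma near_mono: "near r u v \<Longrightarrow> r \<le> r' \<Longrightarrow> near r' u v"
  unfolding near_def using le_trans by blast

lemma near_trans: "near r u v \<Longrightarrow> near r' v w \<Longrightarrow> near (r + r') u w"
  unfolding near_def
proof (elim exE conjE)
  fix a b
  assume "length a \<le> r" "v = fmul a u" "length b \<le> r'" "w = fmul b v"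
  then show "\<exists>c. length c \<le> r + r' \<and> w = fmul c u"
    by (intro exI[of _ "b @ a"]) auto
qed

lemma near_reduced: "near r u v \<Longrightarrow> reduced u \<Longrightarrow> reduced v"
  unfolding near_def by (auto intro: reduced_mult)

lemma near_cons: "1 \<le> r \<Longrightarrow> near r u (cons_letter x u)"
  unfolding near_def by (rule exI[of _ "[x]"]) simp

lemma near_cons': "reduced u \<Longrightarrow> 1 \<le> r \<Longrightarrow> near r (cons_letter x u) u"
  unfolding near_def using cons_letter_cancel[of u "inv_letter x"]
  by (intro exI[of _ "[inv_letter x]"]) simp

lemma near_sym:
  assumes "reduced u" "near r u v" shows "near r v u"
proof -
  obtain w where w: "length w \<le> r" "v = fmul w u" using assms(2) by (auto simp: near_def)
  have "near (length w) (fmul w u) u"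
  proof (induction w)
    case Nil show ?case by (simp add: near_refl)
  next
    case (Cons x w)
    have "near 1 (cons_letter x (fmul w u)) (fmul w u)"
      by (rule near_cons') (auto simp: reduced_mult assms(1))
    from near_trans[OF this Cons.IH] show ?case by simp
  qed
  then show ?thesis using w near_mono by blast
qed

lemma near_mult_right:
  assumes "near r u v" "reduced u" "reduced h" shows "near r (fmul u h) (fmul v h)"
  using assms unfolding near_def by (auto simp: mult_assoc)

lemma finite_words: "finite {w :: letter list. length w \<le> r}"
  using finite_lists_length_le[of "UNIV :: letter set" r] by simp

lemma finite_near: "finite {v. near r u v}"
proof -
  have "{v. near r u v} = (\<lambda>w. fmul w u) ` {w. length w \<le> r}" by (auto simp: near_def)
  then show ?thesis by (simp add: finite_words)
qed

lemma card_near: "card {v. near r u v} \<le> card {w :: letter list. length w \<le> r}"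
proof -
  have "{v. near r u v} = (\<lambda>w. fmul w u) ` {w. length w \<le> r}" by (auto simp: near_def)
  then show ?thesis by (simp add: finite_words card_image_le)
qed

section \<open>Paths inside a subset of the tree\<close>

definition linked :: "letter list set \<Rightarrow> letter list \<Rightarrow> letter list \<Rightarrow> bool" where
  "linked T = (\<lambda>u v. u \<in> T \<and> v \<in> T \<and> (\<exists>x. v = cons_letter x u))\<^sup>*\<^sup>*"

lemma linked_refl: "linked T u u"
  by (simp add: linked_def)

lemma linked_trans: "linked T u v \<Longrightarrow> linked T v w \<Longrightarrow> linked T u w"
  unfolding linked_def by simp

lemma linked_mono: "linked T u v \<Longrightarrow> T \<subseteq> T' \<Longrightarrow> linked T' u v"
  unfolding linked_def by (erule rtranclp_mono[THEN predicate2D, rotated]) auto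

lemma linked_sym:
  assumes "linked T u v" "\<And>t. t \<in> T \<Longrightarrow> reduced t" shows "linked T v u"
  using assms(1) unfolding linked_def
proof (induction rule: rtranclp_induct)
  case base show ?case by simp
next
  case (step v w)
  then obtain x where "w = cons_letter x v" "v \<in> T" "w \<in> T" by blast
  then have "v = cons_letter (inv_letter x) w"
    using cons_letter_cancel[of v "inv_letter x"] assms(2) by simp
  with \<open>v \<in> T\<close> \<open>w \<in> T\<close> show ?case
    by (intro converse_rtranclp_into_rtranclp[OF _ step.IH]) blast
qed

lemma linked_ball:
  assumes "\<And>v. near r c v \<Longrightarrow> v \<in> T" "near r c u" shows "linked T c u"
proof -
  obtain w where w: "length w \<le> r" "u = fmul w c" using assms(2) by (auto simp: near_def)
  have "length w \<le> r \<Longrightarrow> linked T c (fmul w c)"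
  proof (induction w)
    case Nil show ?case by (simp add: linked_refl)
  next
    case (Cons x w)
    then have IH: "linked T c (fmul w c)" by simp
    have "near r c (fmul w c)" unfolding near_def by (rule exI[of _ w]) (use Cons.prems in auto)
    moreover have "near r c (fmul (x # w) c)" unfolding near_def by (rule exI[of _ "x # w"]) (use Cons.prems in auto)
    ultimately have "fmul w c \<in> T" "fmul (x # w) c \<in> T" using assms(1) by blast+
    then have "fmul w c \<in> T \<and> fmul (x # w) c \<in> T \<and> (\<exists>y. fmul (x # w) c = cons_letter y (fmul w c))"
      by (metis comp_apply foldr.simps(2))
    then show ?case unfolding linked_def
      by (rule rtranclp.rtrancl_into_rtrancl[OF IH[unfolded linked_def]])
  qed
  with w show ?thesis by blast
qed

lemma fmul_right_cancel:
  assumes "reduced u" "reduced v" "reduced w" "fmul u w = fmul v w" shows "u = v"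
  using group.right_cancel[OF group_F2, of w u v] assms by (simp add: F2_def)

text \<open>Left multiplication by a letter alters the front of \<open>w\<close>. Its last letter,
  which names the branch at \<open>v\<close>, could change only if \<open>w\<close> became empty,
  that is at \<open>v\<close> itself, which is not in \<open>T\<close>.\<close>

lemma linked_last:
  assumes "linked T (fmul u v) t" "v \<notin> T" "reduced v" "reduced u" "u \<noteq> []"
  shows "\<exists>w. reduced w \<and> w \<noteq> [] \<and> last w = last u \<and> t = fmul w v"
  using assms(1) unfolding linked_def
proof (induction rule: rtranclp_induct)
  case base show ?case using assms by blast
next
  case (step t t')
  then obtain w x where w: "reduced w" "w \<noteq> []" "last w = last u" "t = fmul w v"
    and x: "t' = cons_letter x t" "t' \<in> T" by blast
  have t': "t' = fmul (cons_letter x w) v"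
    using w x assms by (simp add: mult_cons_letter)
  have ne: "cons_letter x w \<noteq> []" using t' x(2) assms(2) by auto
  have "last (cons_letter x w) = last w"
    using ne w(2) by (cases w) auto
  then show ?case using t' ne w reduced_cons_letter by metis
qed

text \<open>The Cayley graph is a tree: a path which avoids \<open>v\<close> stays in one branch at \<open>v\<close>.\<close>

lemma linked_branch:
  assumes "linked T (fmul u v) (fmul w v)" "v \<notin> T" "reduced v" "reduced u" "u \<noteq> []"
    "reduced w" "w \<noteq> []"
  shows "last w = last u"
  using linked_last[OF assms(1-5)] fmul_right_cancel[of w _ v] assms by auto

text \<open>Zorn's lemma for independent sets of a graph. It serves twice, for coloured vertices and
  for spots; in both cases maximality is exploited by counting what blocks a missing
  element.\<close>

lemma maximal_independent:
  assumes "M0 \<subseteq> S" and sym: "\<And>x y. conflict x y \<Longrightarrow> conflict y x"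
    and irr: "\<And>x. \<not> conflict x x"
    and "\<And>x y. x \<in> M0 \<Longrightarrow> y \<in> M0 \<Longrightarrow> \<not> conflict x y"
  obtains M where "M0 \<subseteq> M" "M \<subseteq> S" "\<And>x y. x \<in> M \<Longrightarrow> y \<in> M \<Longrightarrow> \<not> conflict x y"
    "\<And>x. x \<in> S \<Longrightarrow> x \<notin> M \<Longrightarrow> \<exists>y\<in>M. conflict x y"
proof -
  define A where "A = {M. M0 \<subseteq> M \<and> M \<subseteq> S \<and> (\<forall>x\<in>M. \<forall>y\<in>M. \<not> conflict x y)}"
  have "\<exists>M\<in>A. \<forall>X\<in>A. M \<subseteq> X \<longrightarrow> X = M"
  proof (rule subset_Zorn_nonempty)
    have "M0 \<in> A" using assms(1,4) unfolding A_def by simp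
    then show "A \<noteq> {}" by blast
    show "\<Union>C \<in> A" if C: "C \<noteq> {}" "subset.chain A C" for C
    proof -
      have "C \<subseteq> A" using C(2) by (simp add: subset.chain_def)
      moreover have "\<not> conflict x y" if xy: "x \<in> \<Union>C" "y \<in> \<Union>C" for x y
      proof -
        from xy obtain X Y where XY: "X \<in> C" "x \<in> X" "Y \<in> C" "y \<in> Y" by blast
        then have "X \<subseteq> Y \<or> Y \<subseteq> X" using C(2) by (auto simp: subset_chain_def)
        then have "(x \<in> X \<and> y \<in> X) \<or> (x \<in> Y \<and> y \<in> Y)" using XY by blast
        moreover have "X \<in> A" "Y \<in> A" using XY \<open>C \<subseteq> A\<close> by auto
        ultimately show ?thesis unfolding A_def by auto
      qed
      moreover have "M0 \<subseteq> \<Union>C" using C(1) \<open>C \<subseteq> A\<close> unfolding A_def by blast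
      ultimately show ?thesis unfolding A_def by auto
    qed
  qed
  then obtain M where M: "M \<in> A" "\<And>X. X \<in> A \<Longrightarrow> M \<subseteq> X \<Longrightarrow> X = M" by blast
  show thesis
  proof
    show "M0 \<subseteq> M" "M \<subseteq> S" "\<And>x y. x \<in> M \<Longrightarrow> y \<in> M \<Longrightarrow> \<not> conflict x y"
      using M(1) unfolding A_def by auto
    show "\<exists>y\<in>M. conflict x y" if x: "x \<in> S" "x \<notin> M" for x
    proof (rule ccontr)
      assume none: "\<not> ?thesis"
      have "\<not> conflict x y" "\<not> conflict y x" if "y \<in> M" for y
        using none that sym[of y x] by auto
      then have "insert x M \<in> A" using M(1) x(1) irr[of x] unfolding A_def by auto
      then have "insert x M = M" by (rule M(2)) blast
      with x(2) show False by blast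
    qed
  qed
qed

section \<open>Extension of pointers from a part of the tree\<close>

lemma card_letters: "card (UNIV :: letter set) = 4"
  by (simp only: UNIV_Times_UNIV[symmetric] card_cartesian_product) simp

text \<open>
  Outside of \<open>T\<close>, a vertex next to \<open>T\<close> points into \<open>T\<close> and any other vertex points towards
  the root. Each vertex outside of \<open>T\<close> has at most one branch containing points of \<open>T\<close> at
  distance at most two, so at least two of its children point to it.
\<close>

lemma pointer_extension:
  fixes y :: "letter list \<Rightarrow> letter list \<Rightarrow> letter"
  assumes T: "T \<subseteq> {w. reduced w}"
    and lc: "\<And>u v. u \<in> T \<Longrightarrow> v \<in> T \<Longrightarrow> near 4 u v \<Longrightarrow> linked T u v"
    and y: "\<And>t v. t \<in> T \<Longrightarrow> reduced v \<Longrightarrow> 2 \<le> card {s. y t (cons_letter s v) = inv_letter s}"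
    and comp: "\<And>t s. t \<in> T \<Longrightarrow> cons_letter s t \<in> T \<Longrightarrow> y (cons_letter s t) = y t"
  obtains f where "\<And>v. reduced v \<Longrightarrow> 2 \<le> card {s. f (cons_letter s v) = inv_letter s}"
    "\<And>t. t \<in> T \<Longrightarrow> f t = y t t"
proof -
  \<comment> \<open>At the root \<open>hd []\<close> is an unspecified letter. It does no harm: the
    root is the parent of each of its neighbours, and the count below discards the parent through
    \<open>par\<close>.\<close>
  define f where "f v = (if v \<in> T then y v v
     else if \<exists>s. cons_letter s v \<in> T then (SOME s. cons_letter s v \<in> T)
     else inv_letter (hd v))" for v
  \<comment> \<open>Two points within 2 of \<open>v\<close> are within 4 of each other, whence the 4
    in \<open>lc\<close>: they are joined inside \<open>T\<close>, thus without passing through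
    \<open>v\<close>.\<close>
  have branch: "last w = last u"
    if "v \<notin> T" "reduced v" "reduced u" "u \<noteq> []" "reduced w" "w \<noteq> []"
      "fmul u v \<in> T" "fmul w v \<in> T" "length u \<le> 2" "length w \<le> 2" for u v w
  proof (rule linked_branch[of T u v w])
    have "near 2 v (fmul u v)" "near 2 v (fmul w v)" using that by (auto simp: near_def)
    then have "near (2 + 2) (fmul u v) (fmul w v)"
      using near_trans[OF near_sym[OF that(2)]] by blast
    then show "linked T (fmul u v) (fmul w v)" using lc that by simp
  qed (use that in auto)
  have f_near: "f v = s" if "v \<notin> T" "reduced v" "cons_letter s v \<in> T" for v s
  proof -
    have "\<exists>s. cons_letter s v \<in> T" using that(3) by blast
    then have "f v = (SOME s. cons_letter s v \<in> T)" using that(1) unfolding f_def by (simp only: if_False if_True)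
    moreover have "cons_letter (SOME s. cons_letter s v \<in> T) v \<in> T"
      using that(3) by (rule someI)
    ultimately have "cons_letter (f v) v \<in> T" by simp
    then show ?thesis using branch[of v "[s]" "[f v]"] that by simp
  qed
  show thesis
  proof
    show "f t = y t t" if "t \<in> T" for t using that by (simp add: f_def)
    fix v :: "letter list" assume v: "reduced v"
    show "2 \<le> card {s. f (cons_letter s v) = inv_letter s}"
    proof (cases "v \<in> T")
      case True
      have "{s. y v (cons_letter s v) = inv_letter s} \<subseteq> {s. f (cons_letter s v) = inv_letter s}"
      proof safe
        fix a b assume s: "y v (cons_letter (a, b) v) = inv_letter (a, b)"
        let ?s = "(a, b)"
        show "f (cons_letter ?s v) = inv_letter ?s"
        proof (cases "cons_letter ?s v \<in> T")
          case True
          then show ?thesis using s comp[OF \<open>v \<in> T\<close> True] by (simp add: f_def)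
        next
          case False
          have "cons_letter (inv_letter ?s) (cons_letter ?s v) = v"
            using cons_letter_cancel[OF v, of "inv_letter ?s"] by simp
          then show ?thesis using f_near[OF False, of "inv_letter ?s"] v True
            by (simp add: reduced_cons_letter)
        qed
      qed
      then have "card {s. y v (cons_letter s v) = inv_letter s}
          \<le> card {s. f (cons_letter s v) = inv_letter s}"
        by (intro card_mono) auto
      with y[OF True v] show ?thesis by simp
    next
      case False
      \<comment> \<open>These neighbours might point elsewhere than to \<open>v\<close>. Each of
        them leads to a point of \<open>T\<close> within two steps from \<open>v\<close>, and by
        \<open>branch\<close> all such points lie in one branch; so \<open>bad\<close> has at most
        one element, and together with the parent at most two of four neighbours are lost.\<close>
      define bad where "bad = {s. cons_letter s v \<in> T \<or>
        (\<exists>s'. s' \<noteq> inv_letter s \<and> cons_letter s' (cons_letter s v) \<in> T)}"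
      have bad: "\<exists>u. reduced u \<and> u \<noteq> [] \<and> length u \<le> 2 \<and> last u = s \<and> fmul u v \<in> T" if s: "s \<in> bad" for s
      proof (cases "cons_letter s v \<in> T")
        case True
        then show ?thesis by (intro exI[of _ "[s]"]) simp
      next
        case False
        then obtain s' where s': "s' \<noteq> inv_letter s" "cons_letter s' (cons_letter s v) \<in> T"
          using s unfolding bad_def by auto
        have "s \<noteq> inv_letter s'" using s'(1) by auto
        with s'(2) show ?thesis by (intro exI[of _ "[s', s]"]) auto
      qed
      have "s = s'" if "s \<in> bad" "s' \<in> bad" for s s'
        using branch[OF False v] bad[OF that(1)] bad[OF that(2)] by metis
      then have card_bad: "card bad \<le> 1" by (simp add: card_le_Suc0_iff_eq)
      define par where "par = (if v = [] then {} else {inv_letter (hd v)})"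
      have "f (cons_letter s v) = inv_letter s" if s: "s \<notin> bad" "s \<notin> par" for s
      proof -
        have "cons_letter s v = s # v"
          using s(2) unfolding par_def by (cases v) auto
        moreover have "cons_letter s' (cons_letter s v) \<notin> T" for s'
        proof (cases "s' = inv_letter s")
          case True
          then show ?thesis using cons_letter_cancel[OF v, of "inv_letter s"] False by simp
        next
          case False
          then show ?thesis using s(1) unfolding bad_def by blast
        qed
        moreover have "cons_letter s v \<notin> T" using s(1) unfolding bad_def by blast
        ultimately show ?thesis unfolding f_def by simp
      qed
      then have "UNIV - (bad \<union> par) \<subseteq> {s. f (cons_letter s v) = inv_letter s}" by blast
      then have "card (UNIV - (bad \<union> par)) \<le> card {s. f (cons_letter s v) = inv_letter s}"
        by (intro card_mono) auto
      moreover have "card (bad \<union> par) \<le> 2"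
      proof -
        have "card par \<le> 1" unfolding par_def by simp
        then show ?thesis using card_bad card_Un_le[of bad par] by linarith
      qed
      moreover have "card (UNIV - (bad \<union> par)) = 4 - card (bad \<union> par)"
        by (subst card_Diff_subset) (auto simp: card_letters)
      ultimately show ?thesis by linarith
    qed
  qed
qed

section \<open>Distances in the product\<close>

locale countably_infinite_group = group G for G (structure) +
  assumes countable_carrier: "countable (carrier G)" and infinite_carrier: "infinite (carrier G)"
begin

abbreviation \<Gamma> where "\<Gamma> \<equiv> G \<times>\<times> F2"

text \<open>Since \<open>F j F j \<subseteq> F (j + 1)\<close>, the index behaves like the logarithm of a distance.\<close>

primrec F :: "nat \<Rightarrow> 'a set" where
  "F 0 = {\<one>}"
| "F (Suc j) = (\<lambda>(a, b). a \<otimes> b) ` (F j \<times> F j) \<union>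
     {from_nat_into (carrier G) j, inv (from_nat_into (carrier G) j)}"

lemma F2_simps [simp]:
  "carrier F2 = {w. reduced w}" "mult F2 = fmul" "one F2 = []"
  by (simp_all add: F2_def)

lemma group_\<Gamma>: "group \<Gamma>"
  using DirProd_group group_F2 is_group by blast

sublocale \<Gamma>: group \<Gamma>
  by (rule group_\<Gamma>)

lemma carrier_\<Gamma>: "carrier \<Gamma> = carrier G \<times> {w. reduced w}"
  by simp

lemma mult_\<Gamma>: "a \<otimes>\<^bsub>\<Gamma>\<^esub> b = (fst a \<otimes> fst b, fmul (snd a) (snd b))"
  by (cases a; cases b) simp

lemma nonempty_carrier: "carrier G \<noteq> {}"
  using infinite_carrier by auto

lemma from_nat_carrier [simp]: "from_nat_into (carrier G) j \<in> carrier G"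
  by (rule from_nat_into[OF nonempty_carrier])

lemma F_carrier: "F j \<subseteq> carrier G"
  by (induction j) (auto)

lemma finite_F: "finite (F j)"
  by (induction j) auto

lemma one_F: "\<one> \<in> F j"
proof (induction j)
  case (Suc j)
  then have "\<one> \<otimes> \<one> \<in> F (Suc j)" unfolding F.simps by blast
  then show ?case by simp
qed simp

lemma F_Suc_mono: "F j \<subseteq> F (Suc j)"
proof
  fix f assume "f \<in> F j"
  then have "f = f \<otimes> \<one>" using F_carrier[of j] by auto
  moreover have "(f, \<one>) \<in> F j \<times> F j" using \<open>f \<in> F j\<close> one_F by simp
  ultimately show "f \<in> F (Suc j)" by force
qed

lemma F_mono: "i \<le> j \<Longrightarrow> F i \<subseteq> F j"
  by (rule lift_Suc_mono_le[of F, OF F_Suc_mono])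

lemma F_mult: "a \<in> F j \<Longrightarrow> b \<in> F j \<Longrightarrow> a \<otimes> b \<in> F (Suc j)"
  unfolding F.simps by blast

lemma F_inv: "f \<in> F j \<Longrightarrow> inv f \<in> F j"
proof (induction j arbitrary: f)
  case (Suc j)
  from Suc.prems consider a b where "a \<in> F j" "b \<in> F j" "f = a \<otimes> b"
    | "f = from_nat_into (carrier G) j" | "f = inv (from_nat_into (carrier G) j)" by auto
  then show ?case
  proof cases
    case 1
    then have "inv f = inv b \<otimes> inv a" using F_carrier inv_mult_group by blast
    then show ?thesis using F_mult[of "inv b" j "inv a"] Suc.IH 1 by simp
  qed auto
qed simp

lemma F_exhausts: "f \<in> carrier G \<Longrightarrow> \<exists>j. f \<in> F j"
proof -
  assume "f \<in> carrier G"
  then obtain j where "from_nat_into (carrier G) j = f"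
    using from_nat_into_surj countable_carrier by metis
  then have "f \<in> F (Suc j)" by auto
  then show ?thesis by blast
qed

text \<open>The infinity of \<open>G\<close> enters the gluing through this bound: it lets the
  candidates for a new spot outnumber the obstructions.\<close>

lemma F_large: "\<exists>j. N < card (F j)"
proof (rule ccontr)
  assume "\<not> ?thesis"
  then have le: "card (F j) \<le> N" for j by (simp add: not_less)
  obtain B where B: "B \<subseteq> carrier G" "finite B" "card B = Suc N"
    using infinite_carrier infinite_arbitrarily_large by metis
  have "\<exists>j. B \<subseteq> F j" using B(2,1)
  proof (induction B)
    case (insert x B)
    then obtain i j where "B \<subseteq> F i" "x \<in> F j" using F_exhausts by blast
    then have "insert x B \<subseteq> F (max i j)"
      using F_mono[of i "max i j"] F_mono[of j "max i j"] by auto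
    then show ?case by blast
  qed simp
  then obtain j where "B \<subseteq> F j" by blast
  then have "Suc N \<le> card (F j)" using B(3) card_mono finite_F by metis
  with le[of j] show False by simp
qed

definition gclose :: "nat \<Rightarrow> 'a \<Rightarrow> 'a \<Rightarrow> bool" where
  "gclose j g h \<longleftrightarrow> g \<in> carrier G \<and> (\<exists>f\<in>F j. h = f \<otimes> g)"

lemma gclose_carrier: "gclose j g h \<Longrightarrow> g \<in> carrier G \<and> h \<in> carrier G"
  unfolding gclose_def using F_carrier[of j] by auto

lemma gclose_refl: "g \<in> carrier G \<Longrightarrow> gclose j g g"
  unfolding gclose_def using one_F[of j] by (metis l_one)

lemma gclose_mono: "gclose i g h \<Longrightarrow> i \<le> j \<Longrightarrow> gclose j g h"
  unfolding gclose_def using F_mono[of i j] by auto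

lemma gclose_sym: assumes "gclose j g h" shows "gclose j h g"
proof -
  obtain f where f: "f \<in> F j" "h = f \<otimes> g" "g \<in> carrier G" using assms by (auto simp: gclose_def)
  moreover have fc: "f \<in> carrier G" using f(1) F_carrier by blast
  ultimately have "g = inv f \<otimes> h" using inv_solve_left[of g f h] gclose_carrier[OF assms] by simp
  then show ?thesis using F_inv[OF f(1)] gclose_carrier[OF assms] unfolding gclose_def by blast
qed

lemma gclose_trans: assumes "gclose j g h" "gclose j h k" shows "gclose (Suc j) g k"
proof -
  obtain f f' where f: "f \<in> F j" "h = f \<otimes> g" "g \<in> carrier G" "f' \<in> F j" "k = f' \<otimes> h"
    using assms by (auto simp: gclose_def)
  moreover have "f \<in> carrier G" "f' \<in> carrier G" using f(1,4) F_carrier by blast+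
  ultimately have "k = (f' \<otimes> f) \<otimes> g" by (simp add: m_assoc)
  then show ?thesis using f(3) F_mult[OF f(4,1)] unfolding gclose_def by blast
qed

lemma gclose_mult: assumes "gclose j g h" "k \<in> carrier G" shows "gclose j (g \<otimes> k) (h \<otimes> k)"
proof -
  obtain f where f: "f \<in> F j" "h = f \<otimes> g" "g \<in> carrier G" using assms by (auto simp: gclose_def)
  moreover have "f \<in> carrier G" using f(1) F_carrier by blast
  ultimately have "h \<otimes> k = f \<otimes> (g \<otimes> k)" using assms(2) by (simp add: m_assoc)
  moreover have "g \<otimes> k \<in> carrier G" using f(3) assms(2) by (rule m_closed)
  ultimately show ?thesis using f(1) unfolding gclose_def by blast
qed

text \<open>The radius \<open>2 ^ j\<close> doubles when the index grows by one, as \<open>F\<close>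
  does under products, so both coordinates obey the same triangle inequality
  \<open>close_trans\<close>.\<close>

definition close :: "nat \<Rightarrow> 'a \<times> letter list \<Rightarrow> 'a \<times> letter list \<Rightarrow> bool" where
  "close j a b \<longleftrightarrow> reduced (snd a) \<and> gclose j (fst a) (fst b) \<and> near (2 ^ j) (snd a) (snd b)"

lemma close_carrier: "close j a b \<Longrightarrow> a \<in> carrier \<Gamma> \<and> b \<in> carrier \<Gamma>"
  unfolding close_def using gclose_carrier near_reduced by (metis SigmaI carrier_\<Gamma> mem_Collect_eq prod.collapse)

lemma close_refl: "a \<in> carrier \<Gamma> \<Longrightarrow> close j a a"
  unfolding close_def carrier_\<Gamma> using gclose_refl near_refl by auto

lemma close_mono: "close i a b \<Longrightarrow> i \<le> j \<Longrightarrow> close j a b"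
  unfolding close_def using gclose_mono near_mono power_increasing[of i j "2::nat"] by auto

lemma close_sym: "close j a b \<Longrightarrow> close j b a"
  unfolding close_def using gclose_sym near_sym near_reduced by metis

lemma close_trans: assumes "close j a b" "close j b c" shows "close (Suc j) a c"
  using assms near_trans[of "2 ^ j" "snd a" "snd b" "2 ^ j" "snd c"] unfolding close_def
  using gclose_trans by (auto simp: mult_2)

lemma close_trans': "close i a b \<Longrightarrow> close j b c \<Longrightarrow> i \<le> k \<Longrightarrow> j \<le> k \<Longrightarrow> close (Suc k) a c"
  using close_trans close_mono by metis

lemma close_mult:
  assumes "close j a b" "c \<in> carrier \<Gamma>" shows "close j (a \<otimes>\<^bsub>\<Gamma>\<^esub> c) (b \<otimes>\<^bsub>\<Gamma>\<^esub> c)"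
  using assms gclose_mult near_mult_right reduced_mult
  unfolding close_def mult_\<Gamma> carrier_\<Gamma> by (auto simp: mem_Times_iff)

lemma finite_close: "finite {b. close j a b}"
proof -
  have "{b. close j a b} \<subseteq> (\<lambda>f. f \<otimes> fst a) ` F j \<times> {v. near (2 ^ j) (snd a) v}"
    by (force simp: close_def gclose_def)
  then show ?thesis using finite_F finite_near finite_subset by blast
qed

lemma close_exhausts:
  assumes "a \<in> carrier \<Gamma>" "b \<in> carrier \<Gamma>" shows "\<exists>j. close j a b"
proof -
  obtain g u h v where ab: "a = (g, u)" "b = (h, v)" by fastforce
  with assms have c: "g \<in> carrier G" "h \<in> carrier G" "reduced u" "reduced v" by auto
  then obtain i where "h \<otimes> inv g \<in> F i" using F_exhausts[of "h \<otimes> inv g"] by auto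
  then have "gclose i g h" unfolding gclose_def using c by (auto intro!: bexI[of _ "h \<otimes> inv g"] simp: m_assoc)
  moreover have "\<exists>r. near r u v"
  proof -
    obtain u' where u': "reduced u'" "fmul u' u = []" using left_inverse c(3) by blast
    have "fmul (fmul v u') u = v" using mult_assoc[of u' u v] u' c mult_Nil by simp
    then show ?thesis unfolding near_def by (intro exI[of _ "length (fmul v u')"] exI[of _ "fmul v u'"]) auto
  qed
  then obtain r where "near r u v" by blast
  then have "near (2 ^ r) u v" by (rule near_mono) (simp add: less_imp_le)
  ultimately have "gclose (max i r) g h" "near (2 ^ max i r) u v"
    by (auto intro: gclose_mono near_mono)
  then show ?thesis using c(3) unfolding close_def ab by auto
qed

lemma uniform_close_exhausts:
  assumes "finite B" "B \<subseteq> carrier \<Gamma>" "a \<in> carrier \<Gamma>" shows "\<exists>j. \<forall>b\<in>B. close j a b"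
  using assms(1,2)
proof (induction B)
  case (insert x B)
  then obtain i j where "\<forall>b\<in>B. close i a b" "close j a x" using close_exhausts[OF assms(3)] by (metis insert_subset)
  then show ?case by (intro exI[of _ "max i j"]) (auto intro: close_mono)
qed simp

lemma countable_\<Gamma>: "countable (carrier \<Gamma>)"
  using countable_carrier by (simp add: countable_SIGMA)

lemma infinite_\<Gamma>: "infinite (carrier \<Gamma>)"
proof -
  have "[] \<in> {w. reduced w}" by simp
  then show ?thesis using infinite_carrier by (metis carrier_\<Gamma> empty_iff finite_cartesian_productD1)
qed

definition elt :: "nat \<Rightarrow> 'a \<times> letter list" where
  "elt j = from_nat_into (carrier \<Gamma>) j"

lemma elt_carrier: "elt j \<in> carrier \<Gamma>"
  unfolding elt_def by (rule from_nat_into) (use infinite_\<Gamma> in force)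

lemma elt_surj: "a \<in> carrier \<Gamma> \<Longrightarrow> \<exists>j. elt j = a"
  unfolding elt_def using from_nat_into_surj countable_\<Gamma> by metis

section \<open>Layers\<close>

text \<open>A letter is read as the step by which a pointer leaves its vertex: the neighbour reached
  by \<open>s\<close> points back exactly if it carries \<open>inv_letter s\<close>. In the other
  layers letters are merely four colours; the index of the unit must be exempted, as no colouring
  could satisfy its rule.\<close>

definition layer :: "nat \<Rightarrow> ('a \<times> letter list \<Rightarrow> letter) \<Rightarrow> bool" where
  "layer i f = (case i of
     0 \<Rightarrow> \<forall>a\<in>carrier \<Gamma>. 2 \<le> card {s. f (fst a, cons_letter s (snd a)) = inv_letter s}
   | Suc j \<Rightarrow> elt j = \<one>\<^bsub>\<Gamma>\<^esub> \<or> (\<forall>a\<in>carrier \<Gamma>. f (elt j \<otimes>\<^bsub>\<Gamma>\<^esub> a) \<noteq> f a))"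

lemma layer_shift:
  assumes "layer i f" "c \<in> carrier \<Gamma>" shows "layer i (\<lambda>a. f (a \<otimes>\<^bsub>\<Gamma>\<^esub> c))"
proof (cases i)
  case 0
  have "2 \<le> card {s. f ((fst a, cons_letter s (snd a)) \<otimes>\<^bsub>\<Gamma>\<^esub> c) = inv_letter s}"
    if a: "a \<in> carrier \<Gamma>" for a
  proof -
    have "(fst a, cons_letter s (snd a)) \<otimes>\<^bsub>\<Gamma>\<^esub> c
        = (fst (a \<otimes>\<^bsub>\<Gamma>\<^esub> c), cons_letter s (snd (a \<otimes>\<^bsub>\<Gamma>\<^esub> c)))" for s
      using a assms(2) by (auto simp: mult_\<Gamma> mult_cons_letter carrier_\<Gamma> mem_Times_iff)
    moreover have "a \<otimes>\<^bsub>\<Gamma>\<^esub> c \<in> carrier \<Gamma>" using a assms(2) by (rule \<Gamma>.m_closed)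
    ultimately show ?thesis using assms(1) 0 unfolding layer_def by (simp del: carrier_DirProd)
  qed
  then show ?thesis using 0 unfolding layer_def by simp
next
  case (Suc j)
  have "f ((elt j \<otimes>\<^bsub>\<Gamma>\<^esub> a) \<otimes>\<^bsub>\<Gamma>\<^esub> c) \<noteq> f (a \<otimes>\<^bsub>\<Gamma>\<^esub> c)"
    if a: "a \<in> carrier \<Gamma>" "elt j \<noteq> \<one>\<^bsub>\<Gamma>\<^esub>" for a
  proof -
    have "(elt j \<otimes>\<^bsub>\<Gamma>\<^esub> a) \<otimes>\<^bsub>\<Gamma>\<^esub> c = elt j \<otimes>\<^bsub>\<Gamma>\<^esub> (a \<otimes>\<^bsub>\<Gamma>\<^esub> c)"
      using a assms(2) elt_carrier \<Gamma>.m_assoc by blast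
    moreover have "a \<otimes>\<^bsub>\<Gamma>\<^esub> c \<in> carrier \<Gamma>" using a assms(2) by (simp only: \<Gamma>.m_closed)
    ultimately show ?thesis using assms(1) Suc a(2) unfolding layer_def by (simp del: carrier_DirProd)
  qed
  then show ?thesis using Suc unfolding layer_def by auto
qed

section \<open>Extension of partially defined layers\<close>

definition loc_linked :: "nat \<Rightarrow> ('a \<times> letter list) set \<Rightarrow> bool" where
  "loc_linked k A \<longleftrightarrow> (\<forall>g u v. (g, u) \<in> A \<longrightarrow> (g, v) \<in> A \<longrightarrow> near (2 ^ k) u v \<longrightarrow>
     linked {w. (g, w) \<in> A} u v)"

text \<open>Of the configuration \<open>y a\<close> only the value at \<open>a\<close> is to be
  kept. If nearby points carry the same configuration, a rule that relates their values holds
  because it holds in that configuration.\<close>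

definition coherent :: "nat \<Rightarrow> ('a \<times> letter list) set \<Rightarrow> ('a \<times> letter list \<Rightarrow> 'c) \<Rightarrow> bool" where
  "coherent k A y \<longleftrightarrow> (\<forall>a\<in>A. \<forall>b\<in>A. close k a b \<longrightarrow> y a = y b)"

lemma loc_linked_mono: "loc_linked k A \<Longrightarrow> i \<le> k \<Longrightarrow> loc_linked i A"
  unfolding loc_linked_def by (meson near_mono one_le_numeral power_increasing)

lemma coherent_mono: "coherent k A y \<Longrightarrow> i \<le> k \<Longrightarrow> coherent i A y"
  unfolding coherent_def by (meson close_mono)

text \<open>Each copy of the tree is treated separately by \<open>pointer_extension\<close>; the
  index 2 stands for the distance \<open>2 ^ 2 = 4\<close> required there.\<close>

lemma pointer_layer_extension:
  assumes A: "A \<subseteq> carrier \<Gamma>" "loc_linked 2 A" "coherent 2 A y" and y: "\<And>a. a \<in> A \<Longrightarrow> layer 0 (y a)"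
  shows "\<exists>f. layer 0 f \<and> (\<forall>a\<in>A. f a = y a a)"
proof -
  have "\<exists>f. (\<forall>v. reduced v \<longrightarrow> 2 \<le> card {s. f (cons_letter s v) = inv_letter s}) \<and>
      (\<forall>t. (g, t) \<in> A \<longrightarrow> f t = y (g, t) (g, t))" if g: "g \<in> carrier G" for g
  proof -
    obtain f where "\<And>v. reduced v \<Longrightarrow> 2 \<le> card {s. f (cons_letter s v) = inv_letter s}"
      "\<And>t. t \<in> {w. (g, w) \<in> A} \<Longrightarrow> f t = (\<lambda>t v. y (g, t) (g, v)) t t"
    proof (rule pointer_extension[of "{w. (g, w) \<in> A}" "\<lambda>t v. y (g, t) (g, v)"])
      show "{w. (g, w) \<in> A} \<subseteq> {w. reduced w}" using A(1) by auto
      show "linked {w. (g, w) \<in> A} u v"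
        if "u \<in> {w. (g, w) \<in> A}" "v \<in> {w. (g, w) \<in> A}" "near 4 u v" for u v
        using A(2) that unfolding loc_linked_def by simp
      show "2 \<le> card {s. y (g, t) (g, cons_letter s v) = inv_letter s}"
        if "t \<in> {w. (g, w) \<in> A}" "reduced v" for t v
        using y[of "(g, t)"] that g unfolding layer_def by auto
      show "(\<lambda>v. y (g, cons_letter s t) (g, v)) = (\<lambda>v. y (g, t) (g, v))"
        if "t \<in> {w. (g, w) \<in> A}" "cons_letter s t \<in> {w. (g, w) \<in> A}" for s t
      proof -
        have "close 2 (g, t) (g, cons_letter s t)"
          unfolding close_def using that A(1) by (auto intro!: gclose_refl near_cons)
        then have "y (g, t) = y (g, cons_letter s t)"
          using A(3) that unfolding coherent_def by blast
        then show ?thesis by simp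
      qed
    qed blast
    then show ?thesis by (intro exI[of _ f]) auto
  qed
  then obtain f where f: "\<And>g v. g \<in> carrier G \<Longrightarrow> reduced v \<Longrightarrow>
      2 \<le> card {s. f g (cons_letter s v) = inv_letter s}"
    "\<And>g t. g \<in> carrier G \<Longrightarrow> (g, t) \<in> A \<Longrightarrow> f g t = y (g, t) (g, t)" by metis
  show ?thesis
  proof (intro exI conjI ballI)
    show "layer 0 (\<lambda>a. f (fst a) (snd a))" using f(1) unfolding layer_def by auto
    show "f (fst a) (snd a) = y a a" if "a \<in> A" for a using f(2)[of "fst a" "snd a"] A(1) that by auto
  qed
qed

text \<open>Greedy colouring: a vertex is constrained only by its images under
  \<open>\<gamma>\<close> and the inverse of \<open>\<gamma>\<close>, which block at most two of the
  four letters. A maximal conflict-free set of coloured vertices extending the given ones therefore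
  colours every vertex.\<close>

lemma colouring_extension:
  assumes \<gamma>: "\<gamma> \<in> carrier \<Gamma>" "\<gamma> \<noteq> \<one>\<^bsub>\<Gamma>\<^esub>" and A: "A \<subseteq> carrier \<Gamma>"
    and c: "\<And>a. a \<in> A \<Longrightarrow> \<gamma> \<otimes>\<^bsub>\<Gamma>\<^esub> a \<in> A \<Longrightarrow> c (\<gamma> \<otimes>\<^bsub>\<Gamma>\<^esub> a) \<noteq> (c a :: letter)"
  shows "\<exists>f. (\<forall>a\<in>carrier \<Gamma>. f (\<gamma> \<otimes>\<^bsub>\<Gamma>\<^esub> a) \<noteq> f a) \<and> (\<forall>a\<in>A. f a = c a)"
proof -
  define conflict :: "('a \<times> letter list) \<times> letter \<Rightarrow> ('a \<times> letter list) \<times> letter \<Rightarrow> bool"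
    where "conflict = (\<lambda>x y. (fst x = fst y \<and> snd x \<noteq> snd y) \<or>
    (snd x = snd y \<and> (fst x = \<gamma> \<otimes>\<^bsub>\<Gamma>\<^esub> fst y \<or> fst y = \<gamma> \<otimes>\<^bsub>\<Gamma>\<^esub> fst x)))"
  have no_fix: "\<gamma> \<otimes>\<^bsub>\<Gamma>\<^esub> a \<noteq> a" if "a \<in> carrier \<Gamma>" for a
    using \<gamma> that \<Gamma>.r_cancel_one' by metis
  \<comment> \<open>The carrier conditions are built into the relation because it has to be
    irreflexive everywhere, whereas \<open>no_fix\<close> holds on the carrier only.\<close>
  obtain M where M: "(\<lambda>a. (a, c a)) ` A \<subseteq> M" "M \<subseteq> carrier \<Gamma> \<times> (UNIV :: letter set)"
    "\<And>x y. x \<in> M \<Longrightarrow> y \<in> M \<Longrightarrow> \<not> (conflict x y \<and> x \<in> carrier \<Gamma> \<times> UNIV \<and> y \<in> carrier \<Gamma> \<times> UNIV)"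
    "\<And>x. x \<in> carrier \<Gamma> \<times> UNIV \<Longrightarrow> x \<notin> M \<Longrightarrow> \<exists>y\<in>M. conflict x y \<and> x \<in> carrier \<Gamma> \<times> UNIV \<and> y \<in> carrier \<Gamma> \<times> UNIV"
  proof (rule maximal_independent[of "(\<lambda>a. (a, c a)) ` A" "carrier \<Gamma> \<times> UNIV"
        "\<lambda>x y. conflict x y \<and> x \<in> carrier \<Gamma> \<times> UNIV \<and> y \<in> carrier \<Gamma> \<times> UNIV"])
    show "(\<lambda>a. (a, c a)) ` A \<subseteq> carrier \<Gamma> \<times> UNIV" using A by auto
    show "conflict y x \<and> y \<in> carrier \<Gamma> \<times> UNIV \<and> x \<in> carrier \<Gamma> \<times> UNIV"
      if "conflict x y \<and> x \<in> carrier \<Gamma> \<times> UNIV \<and> y \<in> carrier \<Gamma> \<times> UNIV" for x y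
      using that unfolding conflict_def by auto
    show "\<not> (conflict x x \<and> x \<in> carrier \<Gamma> \<times> UNIV \<and> x \<in> carrier \<Gamma> \<times> UNIV)" for x
      using no_fix[of "fst x"] unfolding conflict_def by (auto simp: mem_Times_iff)
    show "\<not> (conflict x y \<and> x \<in> carrier \<Gamma> \<times> UNIV \<and> y \<in> carrier \<Gamma> \<times> UNIV)"
      if "x \<in> (\<lambda>a. (a, c a)) ` A" "y \<in> (\<lambda>a. (a, c a)) ` A" for x y
      using that c unfolding conflict_def by auto metis+
  qed blast
  have nc: "\<not> conflict x y" if "x \<in> M" "y \<in> M" for x y using M(3)[OF that] M(2) that by blast
  have "\<exists>s. (a, s) \<in> M" if a: "a \<in> carrier \<Gamma>" for a
  proof (rule ccontr)
    assume none: "\<not> ?thesis"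
    have "\<exists>b. (b, s) \<in> M \<and> (b = \<gamma> \<otimes>\<^bsub>\<Gamma>\<^esub> a \<or> b = inv\<^bsub>\<Gamma>\<^esub> \<gamma> \<otimes>\<^bsub>\<Gamma>\<^esub> a)" for s
    proof -
      obtain x where x: "x \<in> M" "conflict (a, s) x" using M(4)[of "(a, s)"] none a by blast
      have xc: "fst x \<in> carrier \<Gamma>" using x(1) M(2) by auto
      have "fst x \<noteq> a" using x(1) none by (metis prod.collapse)
      then have "snd x = s" "a = \<gamma> \<otimes>\<^bsub>\<Gamma>\<^esub> fst x \<or> fst x = \<gamma> \<otimes>\<^bsub>\<Gamma>\<^esub> a"
        using x(2) unfolding conflict_def by auto
      moreover have "fst x = inv\<^bsub>\<Gamma>\<^esub> \<gamma> \<otimes>\<^bsub>\<Gamma>\<^esub> a" if "a = \<gamma> \<otimes>\<^bsub>\<Gamma>\<^esub> fst x"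
        using that \<gamma> xc a \<Gamma>.inv_solve_left by metis
      ultimately show ?thesis using x(1) by (metis prod.collapse)
    qed
    then obtain b where b: "\<And>s. (b s, s) \<in> M \<and> (b s = \<gamma> \<otimes>\<^bsub>\<Gamma>\<^esub> a \<or> b s = inv\<^bsub>\<Gamma>\<^esub> \<gamma> \<otimes>\<^bsub>\<Gamma>\<^esub> a)" by metis
    have "inj b"
    proof (rule injI)
      fix s t assume "b s = b t"
      then have "(b s, s) \<in> M" "(b s, t) \<in> M" using b[of s] b[of t] by simp_all
      from nc[OF this] show "s = t" unfolding conflict_def by simp
    qed
    have "b ` UNIV \<subseteq> {\<gamma> \<otimes>\<^bsub>\<Gamma>\<^esub> a, inv\<^bsub>\<Gamma>\<^esub> \<gamma> \<otimes>\<^bsub>\<Gamma>\<^esub> a}"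
      using b by blast
    then have "card (UNIV :: letter set) \<le> card {\<gamma> \<otimes>\<^bsub>\<Gamma>\<^esub> a, inv\<^bsub>\<Gamma>\<^esub> \<gamma> \<otimes>\<^bsub>\<Gamma>\<^esub> a}"
      using card_inj_on_le[OF \<open>inj b\<close>] by blast
    also have "\<dots> \<le> 2" by (simp add: card_insert_if)
    finally show False by (simp add: card_letters)
  qed
  then obtain f where f: "\<And>a. a \<in> carrier \<Gamma> \<Longrightarrow> (a, f a) \<in> M" by metis
  show ?thesis
  proof (intro exI[of _ f] conjI ballI)
    fix a assume a: "a \<in> carrier \<Gamma>"
    then have "\<gamma> \<otimes>\<^bsub>\<Gamma>\<^esub> a \<in> carrier \<Gamma>" using \<gamma>(1) by (simp only: \<Gamma>.m_closed)
    from nc[OF f[OF a] f[OF this]] show "f (\<gamma> \<otimes>\<^bsub>\<Gamma>\<^esub> a) \<noteq> f a"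
      unfolding conflict_def by auto
  next
    fix a assume a: "a \<in> A"
    then have "(a, f a) \<in> M" "(a, c a) \<in> M" using f A M(1) by auto
    from nc[OF this] show "f a = c a" unfolding conflict_def by auto
  qed
qed

text \<open>The bound depends on the layer: 2 for the pointers, and for a colouring an index at
  which \<open>a\<close> and its image under \<open>elt j\<close> are close, so that coherence takes
  both colours from one configuration.\<close>

lemma layer_extension:
  "\<exists>k. \<forall>A y. A \<subseteq> carrier \<Gamma> \<longrightarrow> loc_linked k A \<longrightarrow> coherent k A y \<longrightarrow> (\<forall>a\<in>A. layer i (y a)) \<longrightarrow>
     (\<exists>f. layer i f \<and> (\<forall>a\<in>A. f a = y a a))"
proof (cases i)
  case 0
  then show ?thesis using pointer_layer_extension by blast
next
  case (Suc j)
  obtain k where k: "close k \<one>\<^bsub>\<Gamma>\<^esub> (elt j)" using close_exhausts \<Gamma>.one_closed elt_carrier by blast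
  have "\<exists>f. layer i f \<and> (\<forall>a\<in>A. f a = y a a)"
    if A: "A \<subseteq> carrier \<Gamma>" "coherent k A y" "\<forall>a\<in>A. layer i (y a)" for A y
  proof (cases "elt j = \<one>\<^bsub>\<Gamma>\<^esub>")
    case True
    then show ?thesis using Suc unfolding layer_def by auto
  next
    case False
    have "y (elt j \<otimes>\<^bsub>\<Gamma>\<^esub> a) (elt j \<otimes>\<^bsub>\<Gamma>\<^esub> a) \<noteq> y a a" if a: "a \<in> A" "elt j \<otimes>\<^bsub>\<Gamma>\<^esub> a \<in> A" for a
    proof -
      have ac: "a \<in> carrier \<Gamma>" using a A by blast
      have "close k (\<one>\<^bsub>\<Gamma>\<^esub> \<otimes>\<^bsub>\<Gamma>\<^esub> a) (elt j \<otimes>\<^bsub>\<Gamma>\<^esub> a)" using close_mult[OF k ac] .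
      then have "y a = y (elt j \<otimes>\<^bsub>\<Gamma>\<^esub> a)"
        using A(2) a \<Gamma>.l_one[OF ac] unfolding coherent_def by metis
      moreover have "y a (elt j \<otimes>\<^bsub>\<Gamma>\<^esub> a) \<noteq> y a a"
        using A(3) a(1) ac Suc False unfolding layer_def by (simp del: carrier_DirProd)
      ultimately show ?thesis by metis
    qed
    then obtain f where "\<forall>a\<in>carrier \<Gamma>. f (elt j \<otimes>\<^bsub>\<Gamma>\<^esub> a) \<noteq> f a" "\<forall>a\<in>A. f a = y a a"
      using colouring_extension[OF elt_carrier False A(1), of "\<lambda>a. y a a"] by blast
    then show ?thesis using Suc unfolding layer_def by auto
  qed
  then show ?thesis by blast
qed

end

type_synonym 'g config = "'g \<times> letter list \<Rightarrow> nat \<Rightarrow> letter"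

context countably_infinite_group
begin

declare carrier_DirProd [simp del] one_DirProd [simp del]

section \<open>Stages\<close>

definition legal :: "'a config \<Rightarrow> bool" where
  "legal x \<longleftrightarrow> (\<forall>i. layer i (\<lambda>a. x a i))"

definition shift :: "'a \<times> letter list \<Rightarrow> 'a config \<Rightarrow> 'a config" where
  "shift c x = (\<lambda>b. x (b \<otimes>\<^bsub>\<Gamma>\<^esub> c))"

lemma legal_shift: "legal x \<Longrightarrow> c \<in> carrier \<Gamma> \<Longrightarrow> legal (shift c x)"
  unfolding legal_def shift_def using layer_shift by blast

definition glueable :: "nat \<Rightarrow> nat \<Rightarrow> 'a config set \<Rightarrow> bool" where
  "glueable k n Z \<longleftrightarrow> (\<forall>A y. A \<subseteq> carrier \<Gamma> \<longrightarrow> loc_linked k A \<longrightarrow> coherent k A y \<longrightarrow> y ` A \<subseteq> Z \<longrightarrow>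
     (\<exists>z\<in>Z. \<forall>a\<in>A. \<forall>i<n. z a i = y a a i))"

text \<open>By the third clause membership of a legal configuration depends only on its layers below
  \<open>n\<close> at points of the group. This permits layer \<open>n\<close> to be replaced when
  the next layer is glued.\<close>

definition stage :: "nat \<Rightarrow> 'a config set \<Rightarrow> bool" where
  "stage n Z \<longleftrightarrow> Z \<subseteq> Collect legal \<and> (\<forall>z\<in>Z. \<forall>c\<in>carrier \<Gamma>. shift c z \<in> Z) \<and>
     (\<forall>z\<in>Z. \<forall>z'. legal z' \<longrightarrow> (\<forall>a\<in>carrier \<Gamma>. \<forall>i<n. z' a i = z a i) \<longrightarrow> z' \<in> Z) \<and>
     (\<exists>k. glueable k n Z)"

text \<open>Gluing along the empty set already produces an element.\<close>

lemma stage_nonempty: assumes "stage n Z" shows "Z \<noteq> {}"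
proof -
  obtain k where k: "glueable k n Z" using assms unfolding stage_def by blast
  have "loc_linked k {}" "coherent k {} (\<lambda>_. undefined)"
    by (simp_all add: loc_linked_def coherent_def)
  then show ?thesis using k unfolding glueable_def by blast
qed

lemma legal_nonempty: "\<exists>x. legal x"
proof -
  have "\<exists>f. layer i f" for i
  proof -
    obtain k where k: "\<And>A y. A \<subseteq> carrier \<Gamma> \<Longrightarrow> loc_linked k A \<Longrightarrow> coherent k A y \<Longrightarrow>
        (\<forall>a\<in>A. layer i (y a)) \<Longrightarrow> (\<exists>f. layer i f \<and> (\<forall>a\<in>A. f a = y a a))"
      using layer_extension[of i] by blast
    have "loc_linked k {}" "coherent k {} (\<lambda>_. undefined)"
      by (simp_all add: loc_linked_def coherent_def)
    then show ?thesis using k[of "{}" "\<lambda>_. undefined"] by auto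
  qed
  then obtain f where "\<And>i. layer i (f i)" by metis
  then have "legal (\<lambda>a i. f i a)" by (simp add: legal_def)
  then show ?thesis by blast
qed

lemma stage_0: "stage 0 (Collect legal)"
proof -
  have "glueable 0 0 (Collect legal)" using legal_nonempty by (auto simp: glueable_def)
  then show ?thesis unfolding stage_def using legal_shift by auto
qed

text \<open>The rules of different layers are independent and \<open>Z\<close> restricts layer
  \<open>n\<close> by its own rule only. So the layers below \<open>n\<close> are glued by
  \<open>k\<close>, layer \<open>n\<close> by its extension property, and the results are put
  together.\<close>

lemma stage_Suc: assumes Z: "stage n Z" shows "stage (Suc n) Z"
proof -
  obtain k where k: "glueable k n Z" using Z unfolding stage_def by blast
  obtain l where l: "\<And>A y. A \<subseteq> carrier \<Gamma> \<Longrightarrow> loc_linked l A \<Longrightarrow> coherent l A y \<Longrightarrow>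
      (\<forall>a\<in>A. layer n (y a)) \<Longrightarrow> (\<exists>f. layer n f \<and> (\<forall>a\<in>A. f a = y a a))"
    using layer_extension[of n] by blast
  have "\<exists>z\<in>Z. \<forall>a\<in>A. \<forall>i<Suc n. z a i = y a a i"
    if A: "A \<subseteq> carrier \<Gamma>" "loc_linked (max k l) A" "coherent (max k l) A y" "y ` A \<subseteq> Z" for A y
  proof -
    have "loc_linked k A" "loc_linked l A" "coherent k A y" "coherent l A y"
      using loc_linked_mono[OF A(2)] coherent_mono[OF A(3)] by simp_all
    moreover from this have "coherent l A (\<lambda>a b. y a b n)" unfolding coherent_def by metis
    moreover have "\<forall>a\<in>A. layer n (\<lambda>b. y a b n)"
      using A(4) Z unfolding stage_def legal_def by blast
    moreover obtain z where z: "z \<in> Z" "\<forall>a\<in>A. \<forall>i<n. z a i = y a a i"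
      using k A(1,4) calculation(1,3) unfolding glueable_def by blast
    ultimately obtain f where f: "layer n f" "\<forall>a\<in>A. f a = y a a n"
      using l[OF A(1)] by blast
    define z' where "z' = (\<lambda>a i. if i = n then f a else z a i)"
    have "layer i (\<lambda>a. z' a i)" for i
      using z(1) Z f(1) unfolding z'_def stage_def legal_def by (cases "i = n") auto
    then have "legal z'" by (simp add: legal_def)
    moreover have "\<forall>a\<in>carrier \<Gamma>. \<forall>i<n. z' a i = z a i" unfolding z'_def by simp
    ultimately have "z' \<in> Z" using Z z(1) unfolding stage_def by blast
    moreover have "\<forall>a\<in>A. \<forall>i<Suc n. z' a i = y a a i"
      using z(2) f(2) unfolding z'_def by (auto simp: less_Suc_eq)
    ultimately show ?thesis by blast
  qed
  then have "glueable (max k l) (Suc n) Z" unfolding glueable_def by blast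
  moreover have "z' \<in> Z" if "z \<in> Z" "legal z'" "\<forall>a\<in>carrier \<Gamma>. \<forall>i<Suc n. z' a i = z a i" for z z'
    using Z that unfolding stage_def by (meson less_SucI)
  ultimately show ?thesis using Z unfolding stage_def by blast
qed

section \<open>Patterns, their occurrences and spots\<close>

lemma finite_patterns:
  fixes n :: nat
  assumes "finite B"
  obtains Y where "finite Y" "Y \<subseteq> Z" "\<And>y. y \<in> Z \<Longrightarrow> \<exists>p\<in>Y. \<forall>b\<in>B. \<forall>i<n. (y b i :: letter) = p b i"
proof -
  define r where "r y = restrict (\<lambda>(b, i). y b i :: letter) (B \<times> {..<n})" for y
  have "r ` Z \<subseteq> PiE (B \<times> {..<n}) (\<lambda>_. UNIV)" unfolding r_def by (simp add: image_subset_iff)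
  then have "finite (r ` Z)"
    by (rule finite_subset) (intro finite_PiE finite_cartesian_product assms finite_lessThan finite)
  then obtain Y where Y: "Y \<subseteq> Z" "finite Y" "r ` Z = r ` Y"
    using finite_subset_image[of "r ` Z" r Z] by auto
  show thesis
  proof
    show "\<exists>p\<in>Y. \<forall>b\<in>B. \<forall>i<n. y b i = p b i" if "y \<in> Z" for y
    proof -
      obtain p where p: "p \<in> Y" "r y = r p" using Y(3) \<open>y \<in> Z\<close> by blast
      have "y b i = p b i" if "b \<in> B" "i < n" for b i
        using fun_cong[OF p(2), of "(b, i)"] that unfolding r_def by simp
      then show ?thesis using p(1) by blast
    qed
  qed (use Y in auto)
qed

definition occurs :: "nat \<Rightarrow> 'a config \<Rightarrow> 'a config \<Rightarrow> 'a \<times> letter list \<Rightarrow> bool" where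
  "occurs n z p s \<longleftrightarrow> (\<forall>b. close n s b \<longrightarrow> (\<forall>i<n. z b i = shift (inv\<^bsub>\<Gamma>\<^esub> s) p b i))"

text \<open>
  The first alternative keeps the windows of different spots apart. The second one makes the spots
  of a fixed pattern over a fixed vertex of the tree sparse, so that a new spot finds room
  among the existing ones.
\<close>

definition conflict :: "nat \<Rightarrow> nat \<Rightarrow> ('a \<times> letter list) \<times> 'c \<Rightarrow> ('a \<times> letter list) \<times> 'c \<Rightarrow> bool" where
  "conflict \<sigma> u x y \<longleftrightarrow> x \<noteq> y \<and> (close \<sigma> (fst x) (fst y) \<or>
     snd x = snd y \<and> snd (fst x) = snd (fst y) \<and> gclose u (fst (fst x)) (fst (fst y)))"

text \<open>Bare recurrence of the patterns need not survive gluing. The definition therefore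
  records a selection \<open>M\<close> of occurrences that is separated, so that the windows of
  different spots can be prescribed independently, and still dense over every vertex of the
  tree.\<close>

definition spots :: "nat \<Rightarrow> nat \<Rightarrow> nat \<Rightarrow> nat \<Rightarrow> 'a config set \<Rightarrow> 'a config \<Rightarrow>
    (('a \<times> letter list) \<times> 'a config) set \<Rightarrow> bool" where
  "spots n \<sigma> u m Y z M \<longleftrightarrow> M \<subseteq> carrier \<Gamma> \<times> Y \<and> (\<forall>(s, p)\<in>M. occurs n z p s) \<and>
     (\<forall>x\<in>M. \<forall>y\<in>M. \<not> conflict \<sigma> u x y) \<and>
     (\<forall>d\<in>carrier \<Gamma>. \<forall>p\<in>Y. \<exists>s. (s, p) \<in> M \<and> snd s = snd d \<and> gclose m (fst d) (fst s))"

lemma conflict_sym: "conflict \<sigma> u x y \<Longrightarrow> conflict \<sigma> u y x"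
  unfolding conflict_def using close_sym gclose_sym by metis

lemma conflict_close:
  assumes "conflict \<sigma> u x y" "fst x \<in> carrier \<Gamma>" "\<sigma> \<le> \<nu>" "u \<le> \<nu>" shows "close \<nu> (fst x) (fst y)"
proof -
  have "reduced (snd (fst x))" using assms(2) by (auto simp: carrier_\<Gamma>)
  then have "close u (fst x) (fst y)"
    if "snd (fst x) = snd (fst y)" "gclose u (fst (fst x)) (fst (fst y))"
    using that near_refl unfolding close_def by simp
  then show ?thesis using assms close_mono unfolding conflict_def by blast
qed

lemma occurs_shift:
  assumes "occurs n z p (s \<otimes>\<^bsub>\<Gamma>\<^esub> c)" "s \<in> carrier \<Gamma>" "c \<in> carrier \<Gamma>" shows "occurs n (shift c z) p s"
  unfolding occurs_def
proof (intro allI impI)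
  fix b i assume b: "close n s b" and i: "i < n"
  have bc: "b \<in> carrier \<Gamma>" using close_carrier[OF b] by blast
  have "z (b \<otimes>\<^bsub>\<Gamma>\<^esub> c) i = shift (inv\<^bsub>\<Gamma>\<^esub> (s \<otimes>\<^bsub>\<Gamma>\<^esub> c)) p (b \<otimes>\<^bsub>\<Gamma>\<^esub> c) i"
    using assms(1) close_mult[OF b assms(3)] i unfolding occurs_def by blast
  moreover have "(b \<otimes>\<^bsub>\<Gamma>\<^esub> c) \<otimes>\<^bsub>\<Gamma>\<^esub> inv\<^bsub>\<Gamma>\<^esub> (s \<otimes>\<^bsub>\<Gamma>\<^esub> c) = b \<otimes>\<^bsub>\<Gamma>\<^esub> inv\<^bsub>\<Gamma>\<^esub> s"
  proof -
    have "inv\<^bsub>\<Gamma>\<^esub> (s \<otimes>\<^bsub>\<Gamma>\<^esub> c) = inv\<^bsub>\<Gamma>\<^esub> c \<otimes>\<^bsub>\<Gamma>\<^esub> inv\<^bsub>\<Gamma>\<^esub> s"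
      using assms(2,3) by (rule \<Gamma>.inv_mult_group)
    moreover have "c \<otimes>\<^bsub>\<Gamma>\<^esub> (inv\<^bsub>\<Gamma>\<^esub> c \<otimes>\<^bsub>\<Gamma>\<^esub> inv\<^bsub>\<Gamma>\<^esub> s) = inv\<^bsub>\<Gamma>\<^esub> s"
      using assms(2,3) by (simp only: \<Gamma>.m_assoc[symmetric] \<Gamma>.inv_closed \<Gamma>.r_inv \<Gamma>.l_one)
    ultimately show ?thesis using assms(2,3) bc
      by (simp only: \<Gamma>.m_assoc \<Gamma>.inv_closed \<Gamma>.m_closed)
  qed
  ultimately show "shift c z b i = shift (inv\<^bsub>\<Gamma>\<^esub> s) p b i" unfolding shift_def by simp
qed

text \<open>Density is required over the same vertex of the tree; dividing by \<open>c\<close> on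
  the right keeps both that vertex and the distance in \<open>G\<close>.\<close>

lemma untranslate:
  assumes "s \<in> carrier \<Gamma>" "d \<in> carrier \<Gamma>" "c \<in> carrier \<Gamma>"
    and s: "snd s = snd (d \<otimes>\<^bsub>\<Gamma>\<^esub> c)" "gclose m (fst (d \<otimes>\<^bsub>\<Gamma>\<^esub> c)) (fst s)"
  obtains t where "t \<in> carrier \<Gamma>" "t \<otimes>\<^bsub>\<Gamma>\<^esub> c = s" "snd t = snd d" "gclose m (fst d) (fst t)"
proof
  define t where "t = (fst s \<otimes> inv (fst c), snd d)"
  have comp: "fst s \<in> carrier G" "fst c \<in> carrier G" "fst d \<in> carrier G" "reduced (snd d)"
    using assms(1-3) by (auto simp: carrier_\<Gamma>)
  then show "t \<otimes>\<^bsub>\<Gamma>\<^esub> c = s"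
    using s(1) unfolding t_def by (cases s) (auto simp: mult_\<Gamma> m_assoc)
  show "t \<in> carrier \<Gamma>" using comp unfolding t_def by (auto simp: carrier_\<Gamma>)
  show "gclose m (fst d) (fst t)"
    using gclose_mult[OF s(2), of "inv (fst c)"] comp unfolding t_def by (simp add: mult_\<Gamma> m_assoc)
  show "snd t = snd d" by (simp add: t_def)
qed

lemma spots_shift:
  assumes M: "spots n \<sigma> u m Y z M" and c: "c \<in> carrier \<Gamma>"
  shows "\<exists>M'. spots n \<sigma> u m Y (shift c z) M'"
proof -
  define M' where "M' = {(s, p). s \<in> carrier \<Gamma> \<and> (s \<otimes>\<^bsub>\<Gamma>\<^esub> c, p) \<in> M}"
  have "spots n \<sigma> u m Y (shift c z) M'" unfolding spots_def
  proof (intro conjI ballI)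
    show "M' \<subseteq> carrier \<Gamma> \<times> Y" using M unfolding M'_def spots_def by auto
    show "case x of (s, p) \<Rightarrow> occurs n (shift c z) p s" if x: "x \<in> M'" for x
    proof (clarify)
      fix s p assume sp: "x = (s, p)"
      then have "s \<in> carrier \<Gamma>" "(s \<otimes>\<^bsub>\<Gamma>\<^esub> c, p) \<in> M" using x unfolding M'_def by blast+
      moreover from this have "occurs n z p (s \<otimes>\<^bsub>\<Gamma>\<^esub> c)" using M unfolding spots_def by blast
      ultimately show "occurs n (shift c z) p s" using occurs_shift c by blast
    qed
    show "\<not> conflict \<sigma> u x y" if "x \<in> M'" "y \<in> M'" for x y
    proof
      obtain s p s' p' where xy: "x = (s, p)" "y = (s', p')" by fastforce
      assume "conflict \<sigma> u x y"
      moreover have "s \<in> carrier \<Gamma>" "s' \<in> carrier \<Gamma>" using that xy unfolding M'_def by auto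
      moreover from this have "s \<otimes>\<^bsub>\<Gamma>\<^esub> c = s' \<otimes>\<^bsub>\<Gamma>\<^esub> c \<longleftrightarrow> s = s'"
        using \<Gamma>.right_cancel[OF c] by blast
      ultimately have "conflict \<sigma> u (s \<otimes>\<^bsub>\<Gamma>\<^esub> c, p) (s' \<otimes>\<^bsub>\<Gamma>\<^esub> c, p')"
        using close_mult[of \<sigma> s s' c] gclose_mult[of u "fst s" "fst s'" "fst c"] c
        unfolding conflict_def xy by (auto simp: mult_\<Gamma> carrier_\<Gamma>)
      then show False using that M unfolding xy M'_def spots_def by auto
    qed
    fix d p assume d: "d \<in> carrier \<Gamma>" "p \<in> Y"
    have "d \<otimes>\<^bsub>\<Gamma>\<^esub> c \<in> carrier \<Gamma>" using d c by (simp only: \<Gamma>.m_closed)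
    then obtain s where s: "(s, p) \<in> M" "snd s = snd (d \<otimes>\<^bsub>\<Gamma>\<^esub> c)" "gclose m (fst (d \<otimes>\<^bsub>\<Gamma>\<^esub> c)) (fst s)"
      using M d(2) unfolding spots_def by blast
    moreover have "s \<in> carrier \<Gamma>" using s(1) M unfolding spots_def by auto
    ultimately obtain t where "t \<in> carrier \<Gamma>" "t \<otimes>\<^bsub>\<Gamma>\<^esub> c = s" "snd t = snd d" "gclose m (fst d) (fst t)"
      using untranslate d(1) c by blast
    then show "\<exists>s. (s, p) \<in> M' \<and> snd s = snd d \<and> gclose m (fst d) (fst s)"
      using s(1) unfolding M'_def by blast
  qed
  then show ?thesis by blast
qed

lemma occurs_cong:
  assumes "occurs n z p s" "\<And>b i. close n s b \<Longrightarrow> i < n \<Longrightarrow> z' b i = z b i" shows "occurs n z' p s"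
  using assms unfolding occurs_def by simp

lemma spots_cong:
  assumes "spots n \<sigma> u m Y z M" "\<forall>a\<in>carrier \<Gamma>. \<forall>i<n. z' a i = z a i" shows "spots n \<sigma> u m Y z' M"
proof -
  have "occurs n z' p s" if "(s, p) \<in> M" for s p
    using assms that unfolding spots_def by (auto intro!: occurs_cong[of n z p s z'] dest: close_carrier)
  then show ?thesis using assms(1) unfolding spots_def by auto
qed

section \<open>Gluing configurations together with their spots\<close>

lemma glueable_mono:
  assumes "glueable k n Z" "k \<le> l" shows "glueable l n Z"
  unfolding glueable_def
proof (intro allI impI)
  fix A y
  assume "A \<subseteq> carrier \<Gamma>" "loc_linked l A" "coherent l A y" "y ` A \<subseteq> Z"
  moreover from this have "loc_linked k A" "coherent k A y"
    using loc_linked_mono coherent_mono assms(2) by blast+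
  ultimately show "\<exists>z\<in>Z. \<forall>a\<in>A. \<forall>i<n. z a i = y a a i"
    using assms(1) unfolding glueable_def by blast
qed

text \<open>
  The glued configuration keeps the spots of \<open>y a\<close> near \<open>a\<close>, and a maximal set of further spots
  is chosen away from \<open>A\<close>. Maximality yields density by counting: far from \<open>A\<close>, there are
  \<open>card (F \<mu>)\<close> candidates for a new spot; each existing spot blocks at most \<open>card (F \<sigma>)\<close> of
  them, and the number of blocking spots has a bound independent of \<open>\<mu>\<close>.
\<close>

lemma spots_glue:
  fixes k n \<mu> :: nat and Y :: "'a config set"
  assumes \<sigma>_def: "\<sigma> = k + 3" and \<tau>_def: "\<tau> = Suc (max \<sigma> \<mu>)" and u_def: "u = Suc \<tau>"
    and m_def: "m = Suc (max u \<mu>)" and \<nu>_def: "\<nu> = Suc (max m \<tau>)"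
  assumes glue: "glueable k n Z" and nk: "n \<le> k"
    and inv_Z: "\<And>z c. z \<in> Z \<Longrightarrow> c \<in> carrier \<Gamma> \<Longrightarrow> shift c z \<in> Z"
    and Y: "finite Y" "Y \<subseteq> Z"
    and \<mu>: "card {w :: letter list. length w \<le> 2 ^ \<sigma>} * card Y * card (F \<sigma>) < card (F \<mu>)"
    and A: "A \<subseteq> carrier \<Gamma>" "loc_linked (\<nu> + 2) A" "coherent (\<nu> + 2) A y"
    and y: "\<And>a. a \<in> A \<Longrightarrow> y a \<in> Z \<and> (\<exists>M. spots n \<sigma> u m Y (y a) M)"
  shows "\<exists>z\<in>Z. (\<exists>M. spots n \<sigma> u m Y z M) \<and> (\<forall>a\<in>A. \<forall>i<n. z a i = y a a i)"
proof -
  \<comment> \<open>Origin of the constants. \<open>\<sigma>\<close>: windows reach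
    \<open>Suc k\<close> from their spots, so spots whose windows come \<open>k\<close>-close are
    \<open>(k + 3)\<close>-close. \<open>\<tau>\<close>: if \<open>d\<close> is not
    \<open>\<tau>\<close>-close to \<open>A\<close>, candidates \<open>\<mu>\<close>-close to
    \<open>d\<close> are not \<open>\<sigma>\<close>-close to \<open>A\<close>; moreover spots
    \<open>\<sigma>\<close>-close to candidates are \<open>\<tau>\<close>-close to \<open>d\<close>
    in \<open>G\<close>, hence \<open>u\<close>-close to each other. \<open>m\<close>: a spot
    \<open>u\<close>-close to a candidate in \<open>G\<close> is \<open>m\<close>-close to
    \<open>d\<close>. \<open>\<nu>\<close>: a spot that \<open>y a\<close> has
    \<open>m\<close>-close to some \<open>d\<close>, itself \<open>\<tau>\<close>-close to
    \<open>a\<close>, is \<open>\<nu>\<close>-close to \<open>a\<close>. Finally, owners of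
    \<open>\<nu>\<close>-close spots are \<open>(\<nu> + 2)\<close>-close.\<close>
  have le: "\<sigma> \<le> \<tau>" "\<mu> \<le> \<tau>" "\<tau> \<le> u" "u \<le> m" "\<mu> \<le> m" "m \<le> \<nu>" "\<tau> \<le> \<nu>" "u \<le> \<nu>" "\<sigma> \<le> \<nu>"
    using \<tau>_def u_def m_def \<nu>_def by linarith+
  \<comment> \<open>The selection is a function of the configuration, so points of \<open>A\<close>
    with equal configurations hand on the same spots; hence the inherited spots \<open>M0\<close> do
    not conflict.\<close>
  define S0 where "S0 z = (SOME M. spots n \<sigma> u m Y z M)" for z
  have S0: "spots n \<sigma> u m Y (y a) (S0 (y a))" if "a \<in> A" for a
    using y[OF that] unfolding S0_def by (meson someI_ex)
  define own where "own x a \<longleftrightarrow> a \<in> A \<and> x \<in> S0 (y a) \<and> close \<nu> (fst x) a" for x a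
  define M0 where "M0 = {x. \<exists>a. own x a}"
  define S where "S = M0 \<union> {x \<in> carrier \<Gamma> \<times> Y. \<forall>a\<in>A. \<not> close \<sigma> (fst x) a}"
  have own_carrier: "x \<in> carrier \<Gamma> \<times> Y" if "own x a" for x a
    using that S0 unfolding own_def spots_def by blast
  have y_eq: "y a = y b" if "a \<in> A" "b \<in> A" "close (\<nu> + 2) a b" for a b
    using A(3) that unfolding coherent_def by blast
  have own_eq: "y a = y a'" if "own x a" "own x' a'" "close \<nu> (fst x) (fst x')" for x a x' a'
  proof -
    have "close (Suc \<nu>) a (fst x')"
      using that close_sym close_trans unfolding own_def by blast
    then have "close (\<nu> + 2) a a'"
      using that close_trans'[of "Suc \<nu>" a "fst x'" \<nu> a' "Suc \<nu>"] unfolding own_def by simp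
    then show ?thesis using y_eq that unfolding own_def by blast
  qed
  obtain M where M: "M0 \<subseteq> M" "M \<subseteq> S" "\<And>x y. x \<in> M \<Longrightarrow> y \<in> M \<Longrightarrow> \<not> conflict \<sigma> u x y"
    "\<And>x. x \<in> S \<Longrightarrow> x \<notin> M \<Longrightarrow> \<exists>y\<in>M. conflict \<sigma> u x y"
  proof (rule maximal_independent[of M0 S "conflict \<sigma> u"])
    show "M0 \<subseteq> S" unfolding S_def by blast
    show "\<not> conflict \<sigma> u x x" for x :: "('a \<times> letter list) \<times> 'a config" unfolding conflict_def by blast
    show "\<not> conflict \<sigma> u x x'" if x0: "x \<in> M0" "x' \<in> M0" for x x'
    proof
      assume c: "conflict \<sigma> u x x'"
      obtain a a' where a: "own x a" "own x' a'" using x0 unfolding M0_def by blast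
      have "fst x \<in> carrier \<Gamma>" using own_carrier[OF a(1)] by (simp add: mem_Times_iff)
      then have "y a = y a'" using own_eq[OF a] conflict_close[OF c _ le(9) le(8)] by blast
      then have "x \<in> S0 (y a)" "x' \<in> S0 (y a)" using a unfolding own_def by auto
      then show False using c S0 a(1) unfolding own_def spots_def by blast
    qed
  qed (use conflict_sym in blast)+
  have M_carrier: "fst x \<in> carrier \<Gamma>" "snd x \<in> Y" if "x \<in> M" for x
  proof -
    have "x \<in> carrier \<Gamma> \<times> Y" using that M(2) own_carrier unfolding S_def M0_def by blast
    then show "fst x \<in> carrier \<Gamma>" "snd x \<in> Y" by (simp_all add: mem_Times_iff)
  qed
  have M_unique: "x = x'" if "x \<in> M" "x' \<in> M" "close \<sigma> (fst x) (fst x')" for x x'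
    using M(3)[OF that(1,2)] that(3) unfolding conflict_def by blast
  have dense: "\<exists>s. (s, p) \<in> M \<and> snd s = snd d \<and> gclose m (fst d) (fst s)"
    if d: "d \<in> carrier \<Gamma>" and p: "p \<in> Y" for d p
  proof (cases "\<exists>a\<in>A. close \<tau> d a")
    case True
    then obtain a where a: "a \<in> A" "close \<tau> d a" by blast
    then obtain s where s: "(s, p) \<in> S0 (y a)" "snd s = snd d" "gclose m (fst d) (fst s)"
      using S0 d p unfolding spots_def by blast
    have "close m d s" using s d unfolding close_def by (auto simp: near_refl carrier_\<Gamma>)
    then have "close (Suc (max m \<tau>)) s a"
      using a(2) close_trans'[of m s d \<tau> a "max m \<tau>"] close_sym by simp
    then have "own (s, p) a" using a s unfolding own_def \<nu>_def by simp
    then show ?thesis using s M(1) unfolding M0_def by blast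
  next
    case far: False
    show ?thesis
    proof (rule ccontr)
      assume none: "\<not> ?thesis"
      define sp where "sp v = (v \<otimes> fst d, snd d)" for v
      have dc: "fst d \<in> carrier G" "reduced (snd d)" using d by (auto simp: carrier_\<Gamma>)
      have Fc: "v \<in> carrier G" if "v \<in> F j" for v j using that F_carrier by blast
      have sp_g: "gclose \<mu> (fst d) (fst (sp v))" if "v \<in> F \<mu>" for v
        using that dc unfolding gclose_def sp_def by auto
      have sp_c: "close \<mu> d (sp v)" if "v \<in> F \<mu>" for v
        using sp_g[OF that] dc unfolding close_def by (simp add: sp_def near_refl)
      have "\<exists>x\<in>M. close \<sigma> (sp v) (fst x)" if v: "v \<in> F \<mu>" for v
      proof -
        have "\<not> close \<sigma> (sp v) a" if "a \<in> A" for a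
          using close_trans'[OF sp_c[OF v], of \<sigma> a "max \<sigma> \<mu>"] far that unfolding \<tau>_def by auto
        then have "(sp v, p) \<in> S" using close_carrier[OF sp_c[OF v]] p unfolding S_def by auto
        moreover have "(sp v, p) \<notin> M"
          using none gclose_mono[OF sp_g[OF v] le(5)] by (auto simp: sp_def)
        ultimately obtain x where x: "x \<in> M" "conflict \<sigma> u (sp v, p) x" using M(4) by blast
        \<comment> \<open>A blocking spot of the second kind carries \<open>p\<close> over the right
          vertex and would itself witness density; so all blocking is by closeness.\<close>
        have False if h: "p = snd x" "snd (sp v) = snd (fst x)" "gclose u (fst (sp v)) (fst (fst x))"
        proof -
          have "gclose (max u \<mu>) (fst d) (fst (sp v))" "gclose (max u \<mu>) (fst (sp v)) (fst (fst x))"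
            using gclose_mono[OF sp_g[OF v]] gclose_mono[OF h(3)] by simp_all
          then have "gclose m (fst d) (fst (fst x))" unfolding m_def by (rule gclose_trans)
          moreover have "(fst x, p) \<in> M" using x(1) h(1) by simp
          ultimately show False using none h(2) by (auto simp: sp_def)
        qed
        then show ?thesis using x unfolding conflict_def by auto
      qed
      then obtain f where f: "\<And>v. v \<in> F \<mu> \<Longrightarrow> f v \<in> M" "\<And>v. v \<in> F \<mu> \<Longrightarrow> close \<sigma> (sp v) (fst (f v))"
        by metis
      have "\<exists>w\<in>F \<sigma>. fst (fst (f v)) = w \<otimes> (v \<otimes> fst d)" if "v \<in> F \<mu>" for v
        using f(2)[OF that] unfolding close_def gclose_def sp_def by simp
      then obtain w where w: "\<And>v. v \<in> F \<mu> \<Longrightarrow> w v \<in> F \<sigma>"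
        "\<And>v. v \<in> F \<mu> \<Longrightarrow> fst (fst (f v)) = w v \<otimes> (v \<otimes> fst d)" by metis
      \<comment> \<open>A candidate is recovered from the vertex and pattern of its blocking spot
        together with the offset in \<open>G\<close>: blocking spots of equal vertex and pattern are
        \<open>u\<close>-close, hence equal by the second kind of conflict. The range of
        \<open>\<Phi>\<close> has a bound not involving \<open>\<mu>\<close>.\<close>
      define \<Phi> where "\<Phi> v = ((snd (fst (f v)), snd (f v)), w v)" for v
      let ?B = "({h. near (2 ^ \<sigma>) (snd d) h} \<times> Y) \<times> F \<sigma>"
      have "\<Phi> v \<in> ?B" if v: "v \<in> F \<mu>" for v
        using f(2)[OF v] w(1)[OF v] M_carrier(2)[OF f(1)[OF v]]
        unfolding \<Phi>_def close_def sp_def by simp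
      then have "\<Phi> ` F \<mu> \<subseteq> ?B" by blast
      moreover have "inj_on \<Phi> (F \<mu>)"
      proof (rule inj_onI)
        fix v v' assume v: "v \<in> F \<mu>" "v' \<in> F \<mu>" "\<Phi> v = \<Phi> v'"
        have g: "gclose \<tau> (fst d) (fst (fst (f v)))" if "v \<in> F \<mu>" for v
        proof -
          have "gclose (max \<sigma> \<mu>) (fst d) (fst (sp v))" "gclose (max \<sigma> \<mu>) (fst (sp v)) (fst (fst (f v)))"
            using gclose_mono[OF sp_g[OF that]] f(2)[OF that] gclose_mono unfolding close_def
            by (simp, meson max.cobounded1)
          then show ?thesis unfolding \<tau>_def by (rule gclose_trans)
        qed
        have "gclose u (fst (fst (f v))) (fst (fst (f v')))"
          unfolding u_def using gclose_trans[OF gclose_sym[OF g[OF v(1)]] g[OF v(2)]] .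
        then have "f v = f v'" using M(3)[OF f(1)[OF v(1)] f(1)[OF v(2)]] v(3)
          unfolding conflict_def \<Phi>_def by auto
        then have "w v \<otimes> (v \<otimes> fst d) = w v \<otimes> (v' \<otimes> fst d)"
          using w(2)[OF v(1)] w(2)[OF v(2)] v(3) unfolding \<Phi>_def by simp
        then show "v = v'" using Fc[OF v(1)] Fc[OF v(2)] Fc[OF w(1)[OF v(1)]] dc by simp
      qed
      moreover have "finite ?B" using finite_near Y(1) finite_F by simp
      ultimately have "card (F \<mu>) \<le> card ?B" using card_inj_on_le by blast
      also have "\<dots> \<le> card {w :: letter list. length w \<le> 2 ^ \<sigma>} * card Y * card (F \<sigma>)"
        using card_near by (simp add: card_cartesian_product)
      finally show False using \<mu> by simp
    qed
  qed
  \<comment> \<open>The ball of a spot close to \<open>A\<close> is enlarged until it meets \<open>A\<close>, so that the union with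
    \<open>A\<close> remains connected at small distances.\<close>
  define radius where "radius x g = (if \<exists>w. (g, w) \<in> A \<and> near (2 ^ Suc k) (snd (fst x)) w
      then 2 ^ Suc k else (2 :: nat) ^ n)" for x :: "('a \<times> letter list) \<times> 'a config" and g
  define piece where "piece x = {(g, h). gclose n (fst (fst x)) g \<and> near (radius x g) (snd (fst x)) h}" for x
  define A' where "A' = A \<union> (\<Union>x\<in>M. piece x)"
  \<comment> \<open>The configuration to be imposed on the window of \<open>x\<close>: that of an
    owner for an inherited spot, the translated pattern for a new one.\<close>
  define val where "val x = (if x \<in> M0 then y (SOME a. own x a) else shift (inv\<^bsub>\<Gamma>\<^esub> (fst x)) (snd x))" for x
  have pow: "(2::nat) ^ n \<le> 2 ^ k" using nk by (simp add: power_increasing)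
  have pow': "(2::nat) ^ n \<le> 2 ^ Suc k" by (rule power_increasing) (use nk in simp_all)
  have radius_cases: "(radius x g = 2 ^ Suc k \<and> (\<exists>w. (g, w) \<in> A \<and> near (2 ^ Suc k) (snd (fst x)) w)) \<or>
      (radius x g = 2 ^ n \<and> \<not> (\<exists>w. (g, w) \<in> A \<and> near (2 ^ Suc k) (snd (fst x)) w))" for x g
    by (cases "\<exists>w. (g, w) \<in> A \<and> near (2 ^ Suc k) (snd (fst x)) w") (simp_all only: radius_def if_True if_False simp_thms)
  have radius_le: "radius x g \<le> 2 ^ Suc k" "2 ^ n \<le> radius x g" for x g
    using radius_cases[of x g] pow' by (elim disjE conjE; simp only: order_refl)+
  have piece_close: "close (Suc k) (fst x) b" if x: "x \<in> M" "b \<in> piece x" for x b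
  proof -
    have "gclose n (fst (fst x)) (fst b)" "near (radius x (fst b)) (snd (fst x)) (snd b)"
      using x(2) unfolding piece_def by auto
    then have "gclose (Suc k) (fst (fst x)) (fst b)" "near (2 ^ Suc k) (snd (fst x)) (snd b)"
      using gclose_mono nk le_SucI near_mono[OF _ radius_le(1)] by metis+
    moreover have "reduced (snd (fst x))" using M_carrier(1)[OF x(1)] by (auto simp: carrier_\<Gamma>)
    ultimately show ?thesis unfolding close_def by blast
  qed
  have A'_carrier: "A' \<subseteq> carrier \<Gamma>"
    using A(1) piece_close close_carrier unfolding A'_def by blast
  have piece_unique: "x = x'" if "x \<in> M" "x' \<in> M" "b \<in> piece x" "b' \<in> piece x'" "close k b b'" for x x' b b'
  proof -
    have "close (k + 2) (fst x) b'"
      using close_trans'[OF piece_close[OF that(1,3)] that(5), of "Suc k"] by simp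
    from close_trans'[OF this close_sym[OF piece_close[OF that(2,4)]], of "k + 2"]
    have "close (k + 3) (fst x) (fst x')" by (simp add: numeral_3_eq_3)
    then show ?thesis using M_unique that unfolding \<sigma>_def by blast
  qed
  have val_near: "y a = val x" if "x \<in> M" "a \<in> A" "close \<sigma> (fst x) a" for x a
  proof -
    have x0: "x \<in> M0" using that M(2) unfolding S_def by blast
    then have o: "own x (SOME a. own x a)" unfolding M0_def mem_Collect_eq by (rule someI_ex)
    then have "close \<nu> (fst x) (SOME a. own x a)" unfolding own_def by (elim conjE)
    note o' = close_sym[OF this]
    have "close (Suc \<nu>) (SOME a. own x a) a"
      using close_trans'[OF o' that(3) order_refl le(9)] .
    then have "close (\<nu> + 2) (SOME a. own x a) a" by (rule close_mono) simp
    moreover have "(SOME a. own x a) \<in> A" using o unfolding own_def by blast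
    ultimately show ?thesis using y_eq that(2) x0 unfolding val_def by simp
  qed
  have val_occurs: "occurs n (val x) (snd x) (fst x) \<and> val x \<in> Z" if x: "x \<in> M" for x
  proof (cases "x \<in> M0")
    case True
    then have o: "own x (SOME a. own x a)" unfolding M0_def mem_Collect_eq by (rule someI_ex)
    then have "(SOME a. own x a) \<in> A" "x \<in> S0 (y (SOME a. own x a))" unfolding own_def by blast+
    moreover from this have "occurs n (y (SOME a. own x a)) (snd x) (fst x)"
      using S0 unfolding spots_def by (simp add: split_beta)
    ultimately show ?thesis using y True unfolding val_def by simp
  next
    case False
    have "snd x \<in> Z" "inv\<^bsub>\<Gamma>\<^esub> (fst x) \<in> carrier \<Gamma>"
      using M_carrier[OF x] Y(2) \<Gamma>.inv_closed by blast+
    then show ?thesis using inv_Z False unfolding val_def occurs_def by simp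
  qed
  define y' where "y' b = (if b \<in> A then y b else val (THE x. x \<in> M \<and> b \<in> piece x))" for b
  have y'_piece: "y' b = val x" if "x \<in> M" "b \<in> piece x" for x b
  proof (cases "b \<in> A")
    case True
    have "close \<sigma> (fst x) b" using piece_close[OF that] by (rule close_mono) (simp add: \<sigma>_def)
    then show ?thesis using val_near[OF that(1) True] True unfolding y'_def by simp
  next
    case False
    have "b \<in> carrier \<Gamma>" using close_carrier[OF piece_close[OF that]] by blast
    then have bb: "close k b b" by (rule close_refl)
    have "(THE x. x \<in> M \<and> b \<in> piece x) = x"
    proof (rule the_equality)
      show "x \<in> M \<and> b \<in> piece x" using that by (rule conjI)
      show "x' = x" if "x' \<in> M \<and> b \<in> piece x'" for x'
        using piece_unique[OF conjunct1[OF that] \<open>x \<in> M\<close> conjunct2[OF that] \<open>b \<in> piece x\<close> bb] .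
    qed
    then show ?thesis using False unfolding y'_def by simp
  qed
  have y'_mixed: "y' a = y' b" if "a \<in> A" "x \<in> M" "b \<in> piece x" "close k a b" for a b x
  proof -
    have "close (Suc (Suc k)) (fst x) a"
      using close_trans'[OF piece_close[OF that(2,3)] close_sym[OF that(4)], of "Suc k"] by simp
    then have "close \<sigma> (fst x) a" by (rule close_mono) (simp add: \<sigma>_def)
    then show ?thesis using val_near[OF that(2,1)] y'_piece[OF that(2,3)] that(1) unfolding y'_def by simp
  qed
  have "coherent k A' y'" unfolding coherent_def
  proof (intro ballI impI)
    fix a b assume ab: "a \<in> A'" "b \<in> A'" "close k a b"
    have "k \<le> \<nu> + 2" using le unfolding \<sigma>_def by simp
    then have "close (\<nu> + 2) a b" using ab(3) close_mono by blast
    then have "y' a = y' b" if "a \<in> A" "b \<in> A"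
      using y_eq[OF that] that unfolding y'_def by simp
    moreover have "y' a = y' b" if "a \<in> A" "b \<notin> A"
    proof -
      obtain x where "x \<in> M" "b \<in> piece x" using ab(2) \<open>b \<notin> A\<close> unfolding A'_def by blast
      from y'_mixed[OF \<open>a \<in> A\<close> this ab(3)] show ?thesis .
    qed
    moreover have "y' a = y' b" if "a \<notin> A" "b \<in> A"
    proof -
      obtain x where "x \<in> M" "a \<in> piece x" using ab(1) \<open>a \<notin> A\<close> unfolding A'_def by blast
      from y'_mixed[OF \<open>b \<in> A\<close> this close_sym[OF ab(3)]] show ?thesis by simp
    qed
    moreover have "y' a = y' b" if "a \<notin> A" "b \<notin> A"
    proof -
      obtain x x' where x: "x \<in> M" "a \<in> piece x" "x' \<in> M" "b \<in> piece x'"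
        using ab(1,2) \<open>a \<notin> A\<close> \<open>b \<notin> A\<close> unfolding A'_def by blast
      then have "x = x'" using piece_unique[OF x(1,3,2,4) ab(3)] by blast
      then show ?thesis using y'_piece x by metis
    qed
    ultimately show "y' a = y' b" by blast
  qed
  moreover have "loc_linked k A'" unfolding loc_linked_def
  proof (intro allI impI)
    fix g v v' assume v: "(g, v) \<in> A'" "(g, v') \<in> A'" "near (2 ^ k) v v'"
    let ?T = "{w. (g, w) \<in> A'}"
    have red: "reduced t" if "t \<in> ?T" for t using that A'_carrier by (auto simp: carrier_\<Gamma>)
    have sym: "linked ?T t s" if "linked ?T s t" for s t
      using that by (rule linked_sym) (rule red)
    have gc: "g \<in> carrier G" using v A'_carrier by (auto simp: carrier_\<Gamma>)
    have in_A: "linked ?T w w'" if "(g, w) \<in> A" "(g, w') \<in> A" "near (2 ^ (k + 3)) w w'" for w w'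
    proof -
      have "near (2 ^ (\<nu> + 2)) w w'"
        using that(3) by (rule near_mono) (rule power_increasing, use le(9) in \<open>simp_all add: \<sigma>_def\<close>)
      then have "linked {w. (g, w) \<in> A} w w'" using A(2) that(1,2) unfolding loc_linked_def by blast
      then show ?thesis by (rule linked_mono) (auto simp: A'_def)
    qed
    have in_ball: "linked ?T (snd (fst x)) w" if "x \<in> M" "(g, w) \<in> piece x" for x w
    proof (rule linked_ball[of "radius x g"])
      show "t \<in> ?T" if "near (radius x g) (snd (fst x)) t" for t
      proof -
        have "(g, t) \<in> piece x" using that \<open>(g, w) \<in> piece x\<close> unfolding piece_def by simp
        then show ?thesis using \<open>x \<in> M\<close> unfolding A'_def by blast
      qed
      show "near (radius x g) (snd (fst x)) w" using that unfolding piece_def by blast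
    qed
    have mixed: "linked ?T w w'"
      if w: "(g, w) \<in> A" and x: "x \<in> M" "(g, w') \<in> piece x" and ww: "near (2 ^ k) w w'" for w w' x
    proof -
      have rx: "reduced (snd (fst x))" using M_carrier(1)[OF x(1)] by (auto simp: carrier_\<Gamma>)
      have w': "near (radius x g) (snd (fst x)) w'" using x(2) unfolding piece_def by blast
      have rw: "reduced w" "reduced w'" using red[of w] w near_reduced[OF w' rx] unfolding A'_def by auto
      \<comment> \<open>With the small radius, \<open>w\<close> would lie within
        \<open>2 ^ n + 2 ^ k \<le> 2 ^ Suc k\<close> of the centre and force the large one. So the
        ball is large and contains a point \<open>t\<close> of \<open>A\<close>, through which
        \<open>w\<close> and \<open>w'\<close> are linked.\<close>
      have "radius x g \<noteq> 2 ^ n \<or> (\<exists>w. (g, w) \<in> A \<and> near (2 ^ Suc k) (snd (fst x)) w)"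
      proof (rule ccontr)
        assume "\<not> ?thesis"
        then have none: "\<not> (\<exists>w. (g, w) \<in> A \<and> near (2 ^ Suc k) (snd (fst x)) w)" and "radius x g = 2 ^ n"
          by blast+
        then have "near (2 ^ n + 2 ^ k) (snd (fst x)) w"
          using near_trans[OF w' near_sym[OF rw(1) ww]] by (simp only:)
        then have "near (2 ^ Suc k) (snd (fst x)) w" by (rule near_mono) (use pow in simp)
        then show False using none w by blast
      qed
      then obtain t where t: "(g, t) \<in> A" "near (2 ^ Suc k) (snd (fst x)) t" and R: "radius x g = 2 ^ Suc k"
        using radius_cases[of x g] by blast
      have "(g, t) \<in> piece x" using x(2) t(2) R unfolding piece_def by simp
      then have "linked ?T (snd (fst x)) t" "linked ?T (snd (fst x)) w'" using in_ball x by blast+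
      then have "linked ?T t w'" using linked_trans[OF sym] by blast
      \<comment> \<open>The route over \<open>w'\<close> and the centre has length at most
        \<open>2 ^ k + 2 * 2 ^ Suc k\<close>, which is five times \<open>2 ^ k\<close>.\<close>
      moreover have "near (2 ^ (k + 3)) w t"
      proof -
        have "near (2 ^ Suc k) w' (snd (fst x))" using near_sym[OF rx w'] R by simp
        from near_trans[OF near_trans[OF ww this] t(2)] show ?thesis
          by (rule near_mono) (simp add: power_add)
      qed
      then have "linked ?T w t" using in_A w t(1) by blast
      ultimately show ?thesis using linked_trans by blast
    qed
    show "linked ?T v v'"
    proof (cases "(g, v) \<in> A")
      case vA: True
      show ?thesis
      proof (cases "(g, v') \<in> A")
        case True
        have "near (2 ^ (k + 3)) v v'" using v(3) by (rule near_mono) (simp add: power_increasing)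
        then show ?thesis using in_A vA True by blast
      next
        case False
        then obtain x where "x \<in> M" "(g, v') \<in> piece x" using v(2) unfolding A'_def by blast
        from mixed[OF vA this v(3)] show ?thesis .
      qed
    next
      case False
      then obtain x where x: "x \<in> M" "(g, v) \<in> piece x" using v(1) unfolding A'_def by blast
      show ?thesis
      proof (cases "(g, v') \<in> A")
        case True
        have "near (2 ^ k) v' v" using near_sym[OF _ v(3)] red[of v] v(1) by simp
        from sym[OF mixed[OF True x this]] show ?thesis .
      next
        case False
        then obtain x' where x': "x' \<in> M" "(g, v') \<in> piece x'" using v(2) unfolding A'_def by blast
        have "close k (g, v) (g, v')" using v red gclose_refl[OF gc] unfolding close_def by simp
        \<comment> \<open>Windows of different spots are not \<open>k\<close>-close, so both points
          lie in one ball and are linked through its centre.\<close>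
        then have "x = x'" using piece_unique[OF x(1) x'(1) x(2) x'(2)] by blast
        then show ?thesis using linked_trans[OF sym[OF in_ball[OF x]]] in_ball[OF x'] by blast
      qed
    qed
  qed
  moreover have "y' ` A' \<subseteq> Z"
  proof
    fix t assume "t \<in> y' ` A'"
    then obtain b where b: "b \<in> A'" "t = y' b" by blast
    show "t \<in> Z"
    proof (cases "b \<in> A")
      case True
      then show ?thesis using b y unfolding y'_def by simp
    next
      case False
      then obtain x where "x \<in> M" "b \<in> piece x" using b unfolding A'_def by blast
      then show ?thesis using y'_piece val_occurs b(2) by simp
    qed
  qed
  ultimately obtain z where z: "z \<in> Z" "\<forall>a\<in>A'. \<forall>i<n. z a i = y' a a i"
    using glue A'_carrier unfolding glueable_def by blast
  have "occurs n z (snd x) (fst x)" if x: "x \<in> M" for x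
  proof (rule occurs_cong)
    show "occurs n (val x) (snd x) (fst x)" using val_occurs x by blast
    fix b i assume b: "close n (fst x) b" "i < n"
    then have "b \<in> piece x" using near_mono[OF _ radius_le(2)] unfolding close_def piece_def by (cases b) auto
    then have "b \<in> A'" "y' b = val x" using y'_piece x unfolding A'_def by blast+
    then show "z b i = val x b i" using z(2) b(2) by simp
  qed
  then have "spots n \<sigma> u m Y z M"
    using M(3) M_carrier dense unfolding spots_def by (auto simp: mem_Times_iff split_beta)
  moreover have "\<forall>a\<in>A. \<forall>i<n. z a i = y a a i"
    using z(2) unfolding A'_def y'_def by simp
  ultimately show ?thesis using z(1) by blast
qed

text \<open>The configurations of \<open>Z\<close> that admit spots for finitely many
  representatives \<open>Y\<close> of all \<open>n\<close>-patterns form the refined stage; its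
  gluing property is \<open>spots_glue\<close>.\<close>

lemma stage_refine:
  assumes Z: "stage n Z"
  shows "\<exists>Z' m. Z' \<subseteq> Z \<and> stage n Z' \<and> (\<forall>z\<in>Z'. \<forall>y\<in>Z. \<forall>d\<in>carrier \<Gamma>.
     \<exists>s\<in>carrier \<Gamma>. snd s = snd d \<and> gclose m (fst d) (fst s) \<and> occurs n z y s)"
proof -
  obtain k0 where "glueable k0 n Z" using Z unfolding stage_def by blast
  then have glue: "glueable (max k0 n) n Z" by (rule glueable_mono) simp
  define k where "k = max k0 n"
  obtain Y where Y: "finite Y" "Y \<subseteq> Z"
    "\<And>y. y \<in> Z \<Longrightarrow> \<exists>p\<in>Y. \<forall>b\<in>{b. close n \<one>\<^bsub>\<Gamma>\<^esub> b}. \<forall>i<n. y b i = p b i"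
    using finite_patterns[OF finite_close] by metis
  define \<sigma> where "\<sigma> = k + 3"
  \<comment> \<open>The left-hand side is fixed by \<open>\<sigma>\<close> and \<open>Y\<close>
    before \<open>\<mu>\<close> is chosen, so there is no circularity.\<close>
  obtain \<mu> where \<mu>: "card {w :: letter list. length w \<le> 2 ^ \<sigma>} * card Y * card (F \<sigma>) < card (F \<mu>)"
    using F_large by blast
  define \<tau> where "\<tau> = Suc (max \<sigma> \<mu>)"
  define u where "u = Suc \<tau>"
  define m where "m = Suc (max u \<mu>)"
  define \<nu> where "\<nu> = Suc (max m \<tau>)"
  define Z' where "Z' = {z \<in> Z. \<exists>M. spots n \<sigma> u m Y z M}"
  have inv_Z: "shift c z \<in> Z" if "z \<in> Z" "c \<in> carrier \<Gamma>" for z c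
    using Z that unfolding stage_def by blast
  have "glueable (\<nu> + 2) n Z'" unfolding glueable_def
  proof (intro allI impI)
    fix A y assume A: "A \<subseteq> carrier \<Gamma>" "loc_linked (\<nu> + 2) A" "coherent (\<nu> + 2) A y" "y ` A \<subseteq> Z'"
    have "\<exists>z\<in>Z. (\<exists>M. spots n \<sigma> u m Y z M) \<and> (\<forall>a\<in>A. \<forall>i<n. z a i = y a a i)"
    proof (rule spots_glue[OF \<sigma>_def \<tau>_def u_def m_def \<nu>_def _ _ inv_Z Y(1,2) \<mu> A(1-3)])
      show "glueable k n Z" "n \<le> k" using glue unfolding k_def by simp_all
      show "y a \<in> Z \<and> (\<exists>M. spots n \<sigma> u m Y (y a) M)" if "a \<in> A" for a
        using A(4) that unfolding Z'_def by blast
    qed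
    then show "\<exists>z\<in>Z'. \<forall>a\<in>A. \<forall>i<n. z a i = y a a i" unfolding Z'_def by blast
  qed
  moreover have "z' \<in> Z'" if z: "z \<in> Z'" "legal z'" "\<forall>a\<in>carrier \<Gamma>. \<forall>i<n. z' a i = z a i" for z z'
  proof -
    obtain M where "spots n \<sigma> u m Y z M" "z \<in> Z" using z(1) unfolding Z'_def by blast
    moreover from this have "spots n \<sigma> u m Y z' M" using spots_cong z(3) by blast
    moreover have "z' \<in> Z" using Z \<open>z \<in> Z\<close> z(2,3) unfolding stage_def by blast
    ultimately show ?thesis unfolding Z'_def by blast
  qed
  moreover have "shift c z \<in> Z'" if "z \<in> Z'" "c \<in> carrier \<Gamma>" for z c
    using that inv_Z spots_shift unfolding Z'_def by blast
  moreover have "Z' \<subseteq> Collect legal" using Z unfolding Z'_def stage_def by blast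
  ultimately have "stage n Z'" unfolding stage_def by blast
  moreover have "\<exists>s\<in>carrier \<Gamma>. snd s = snd d \<and> gclose m (fst d) (fst s) \<and> occurs n z y s"
    if z: "z \<in> Z'" "y \<in> Z" "d \<in> carrier \<Gamma>" for z y d
  proof -
    obtain M where M: "spots n \<sigma> u m Y z M" using z unfolding Z'_def by blast
    obtain p where p: "p \<in> Y" "\<forall>b\<in>{b. close n \<one>\<^bsub>\<Gamma>\<^esub> b}. \<forall>i<n. y b i = p b i" using Y(3)[OF z(2)] by blast
    obtain s where s: "(s, p) \<in> M" "snd s = snd d" "gclose m (fst d) (fst s)"
      using M z(3) p(1) unfolding spots_def by blast
    have sc: "s \<in> carrier \<Gamma>" using M s(1) unfolding spots_def by blast
    have "shift (inv\<^bsub>\<Gamma>\<^esub> s) p b i = shift (inv\<^bsub>\<Gamma>\<^esub> s) y b i" if b: "close n s b" "i < n" for b i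
    proof -
      have "close n (s \<otimes>\<^bsub>\<Gamma>\<^esub> inv\<^bsub>\<Gamma>\<^esub> s) (b \<otimes>\<^bsub>\<Gamma>\<^esub> inv\<^bsub>\<Gamma>\<^esub> s)"
        using close_mult[OF b(1) \<Gamma>.inv_closed[OF sc]] .
      then have "close n \<one>\<^bsub>\<Gamma>\<^esub> (b \<otimes>\<^bsub>\<Gamma>\<^esub> inv\<^bsub>\<Gamma>\<^esub> s)" using \<Gamma>.r_inv[OF sc] by simp
      then have "y (b \<otimes>\<^bsub>\<Gamma>\<^esub> inv\<^bsub>\<Gamma>\<^esub> s) i = p (b \<otimes>\<^bsub>\<Gamma>\<^esub> inv\<^bsub>\<Gamma>\<^esub> s) i"
        using p(2) b(2) by blast
      then show ?thesis unfolding shift_def by simp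
    qed
    moreover have "occurs n z p s" using M s(1) unfolding spots_def by blast
    ultimately have "occurs n z y s" unfolding occurs_def by simp
    then show ?thesis using s sc by blast
  qed
  moreover have "Z' \<subseteq> Z" unfolding Z'_def by blast
  ultimately show ?thesis by (intro exI[of _ Z'] exI[of _ m] conjI ballI)
qed

end

section \<open>The limit flow\<close>

definition cantor :: "point topology" where
  "cantor = product_topology (\<lambda>_. discrete_topology UNIV) UNIV"

lemma topspace_cantor [simp]: "topspace cantor = UNIV"
  unfolding cantor_def by (simp add: PiE_UNIV_domain)

lemma compact_cantor: "compact_space cantor"
  unfolding cantor_def by (simp add: compact_space_product_topology compact_space_discrete_topology)

lemma Hausdorff_cantor: "Hausdorff_space cantor"
  unfolding cantor_def by (simp add: Hausdorff_space_product_topology Hausdorff_space_discrete_topology)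

lemma openin_cylinder:
  assumes "finite K" shows "openin cantor {x'. \<forall>k\<in>K. x' k = x k}"
proof -
  have "openin cantor (PiE UNIV (\<lambda>k. if k \<in> K then {x k} else UNIV))"
    unfolding cantor_def
  proof (rule product_topology_basis)
    have "{k. (if k \<in> K then {x k} else UNIV) \<noteq> topspace (discrete_topology UNIV)} \<subseteq> K" by auto
    then show "finite {k. (if k \<in> K then {x k} else UNIV) \<noteq> topspace (discrete_topology UNIV)}"
      using assms finite_subset by blast
  qed simp
  moreover have "PiE UNIV (\<lambda>k. if k \<in> K then {x k} else UNIV) = {x'. \<forall>k\<in>K. x' k = x k}"
    by (auto simp: PiE_UNIV_domain Pi_iff split: if_splits)
  ultimately show ?thesis by simp
qed

lemma cylinder_nbhd:
  assumes "openin cantor U" "y \<in> U"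
  obtains K where "finite K" "\<And>x. (\<And>k. k \<in> K \<Longrightarrow> x k = y k) \<Longrightarrow> x \<in> U"
proof -
  obtain W where W: "finite {i. W i \<noteq> UNIV}" "y \<in> PiE UNIV W" "PiE UNIV W \<subseteq> U"
    using assms unfolding cantor_def openin_product_topology_alt by fastforce
  show thesis
  proof
    show "finite {i. W i \<noteq> UNIV}" by (rule W(1))
    show "x \<in> U" if x: "\<And>k. k \<in> {i. W i \<noteq> UNIV} \<Longrightarrow> x k = y k" for x
    proof -
      have "x k \<in> W k" for k
      proof (cases "W k = UNIV")
        case False
        then have "x k = y k" using x by simp
        moreover have "y k \<in> W k" using W(2) by (auto simp: PiE_UNIV_domain)
        ultimately show ?thesis by simp
      qed simp
      then show ?thesis using W(3) by (auto simp: PiE_UNIV_domain)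
    qed
  qed
qed

lemma openin_finitely_determined:
  assumes "finite K" "\<And>x x'. (\<And>k. k \<in> K \<Longrightarrow> x k = x' k) \<Longrightarrow> P x \<Longrightarrow> P x'"
  shows "openin cantor {x. P x}"
proof (subst openin_subopen, intro ballI)
  fix x assume x: "x \<in> {x. P x}"
  show "\<exists>T. openin cantor T \<and> x \<in> T \<and> T \<subseteq> {x. P x}"
  proof (intro exI conjI)
    show "openin cantor {x'. \<forall>k\<in>K. x' k = x k}" using openin_cylinder[OF assms(1)] .
    show "{x'. \<forall>k\<in>K. x' k = x k} \<subseteq> {x. P x}" using assms(2)[of x] x by auto
  qed simp
qed

context countably_infinite_group
begin

text \<open>Coding a configuration and decoding it preserves values at points of the group only;
  such congruences make the values elsewhere harmless.\<close>

lemma layer_cong: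
  assumes "layer i f" "\<And>a. a \<in> carrier \<Gamma> \<Longrightarrow> f' a = f a" shows "layer i f'"
proof (cases i)
  case 0
  have "(fst a, cons_letter s (snd a)) \<in> carrier \<Gamma>" if "a \<in> carrier \<Gamma>" for a s
    using that reduced_cons_letter[of "snd a" s] by (auto simp: carrier_\<Gamma>)
  then show ?thesis using assms 0 unfolding layer_def by simp
next
  case (Suc j)
  have "elt j \<otimes>\<^bsub>\<Gamma>\<^esub> a \<in> carrier \<Gamma>" if "a \<in> carrier \<Gamma>" for a
    using elt_carrier that by (rule \<Gamma>.m_closed)
  then show ?thesis using assms Suc unfolding layer_def by simp
qed

lemma legal_cong:
  assumes "legal x" "\<And>a i. a \<in> carrier \<Gamma> \<Longrightarrow> x' a i = x a i" shows "legal x'"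
  using assms layer_cong unfolding legal_def by metis

text \<open>Refinement and addition of a layer alternate: \<open>stage_refine\<close> keeps the
  index \<open>n\<close>, and \<open>stage_Suc\<close> raises it for the same set.\<close>

lemma stage_sequence:
  obtains Z m where "\<And>n. stage n (Z n)" "\<And>n. Z (Suc n) \<subseteq> Z n"
    "\<And>n z y d. z \<in> Z (Suc n) \<Longrightarrow> y \<in> Z n \<Longrightarrow> d \<in> carrier \<Gamma> \<Longrightarrow>
      \<exists>s\<in>carrier \<Gamma>. snd s = snd d \<and> gclose (m n) (fst d) (fst s) \<and> occurs n z y s"
proof -
  define R where "R n W W' m \<longleftrightarrow> W' \<subseteq> W \<and> (\<forall>z\<in>W'. \<forall>y\<in>W. \<forall>d\<in>carrier \<Gamma>.
     \<exists>s\<in>carrier \<Gamma>. snd s = snd d \<and> gclose m (fst d) (fst s) \<and> occurs n z y s)" for n W W' m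
  have "\<exists>W'. stage (Suc n) W' \<and> (\<exists>m. R n W W' m)" if W: "stage n W" for n W
  proof -
    obtain W' m where "stage n W'" "R n W W' m" using stage_refine[OF W] unfolding R_def by blast
    then show ?thesis using stage_Suc[of n W'] by blast
  qed
  then have "\<exists>Z. \<forall>n. stage n (Z n) \<and> (\<exists>m. R n (Z n) (Z (Suc n)) m)"
    using stage_0 by (intro dependent_nat_choice) blast+
  then obtain Z where Z: "\<And>n. stage n (Z n)" "\<And>n. \<exists>m. R n (Z n) (Z (Suc n)) m" by blast
  then obtain m where "\<And>n. R n (Z n) (Z (Suc n)) (m n)" by metis
  then show thesis using that[of Z m] Z(1) unfolding R_def by blast
qed

text \<open>Stages are not shown to be closed, so the limit avoids membership in \<open>Z\<close>.
  The first clause retains what is needed of it, that windows of \<open>x\<close> are windows of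
  members of \<open>Z\<close>; the second is recurrence. For fixed \<open>d\<close> and
  \<open>y\<close> each concerns finitely many values of \<open>x\<close> and so survives
  limits.\<close>

definition good :: "nat \<Rightarrow> 'a config set \<Rightarrow> nat \<Rightarrow> 'a config \<Rightarrow> bool" where
  "good n Z m x \<longleftrightarrow>
    (\<forall>d\<in>carrier \<Gamma>. \<exists>y\<in>Z. \<forall>b. close n \<one>\<^bsub>\<Gamma>\<^esub> b \<longrightarrow> (\<forall>i<n. x (b \<otimes>\<^bsub>\<Gamma>\<^esub> d) i = y b i)) \<and>
    (\<forall>y\<in>Z. \<forall>d\<in>carrier \<Gamma>. \<exists>s\<in>carrier \<Gamma>. snd s = snd d \<and> gclose m (fst d) (fst s) \<and> occurs n x y s)"

lemma good_cong:
  assumes "good n Z m x" "\<And>a i. a \<in> carrier \<Gamma> \<Longrightarrow> x' a i = x a i" shows "good n Z m x'"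
proof -
  have "x' (b \<otimes>\<^bsub>\<Gamma>\<^esub> d) i = x (b \<otimes>\<^bsub>\<Gamma>\<^esub> d) i" if "close n \<one>\<^bsub>\<Gamma>\<^esub> b" "d \<in> carrier \<Gamma>" for b d i
    using close_carrier[OF that(1)] that(2) assms(2) \<Gamma>.m_closed by blast
  moreover have "occurs n x' y s" if "occurs n x y s" for y s
    using that by (rule occurs_cong) (use close_carrier assms(2) in blast)
  ultimately show ?thesis using assms(1) unfolding good_def by (metis (no_types, lifting))
qed

lemma good_shift:
  assumes x: "good n Z m x" and c: "c \<in> carrier \<Gamma>" shows "good n Z m (shift c x)"
  unfolding good_def
proof (intro conjI ballI)
  fix d assume d: "d \<in> carrier \<Gamma>"
  have dc: "d \<otimes>\<^bsub>\<Gamma>\<^esub> c \<in> carrier \<Gamma>" using d c by (rule \<Gamma>.m_closed)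
  have "b \<otimes>\<^bsub>\<Gamma>\<^esub> (d \<otimes>\<^bsub>\<Gamma>\<^esub> c) = (b \<otimes>\<^bsub>\<Gamma>\<^esub> d) \<otimes>\<^bsub>\<Gamma>\<^esub> c" if "close n \<one>\<^bsub>\<Gamma>\<^esub> b" for b
    using close_carrier[OF that] d c \<Gamma>.m_assoc by simp
  moreover obtain y where "y \<in> Z" "\<forall>b. close n \<one>\<^bsub>\<Gamma>\<^esub> b \<longrightarrow> (\<forall>i<n. x (b \<otimes>\<^bsub>\<Gamma>\<^esub> (d \<otimes>\<^bsub>\<Gamma>\<^esub> c)) i = y b i)"
    using x dc unfolding good_def by blast
  ultimately show "\<exists>y\<in>Z. \<forall>b. close n \<one>\<^bsub>\<Gamma>\<^esub> b \<longrightarrow> (\<forall>i<n. shift c x (b \<otimes>\<^bsub>\<Gamma>\<^esub> d) i = y b i)"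
    unfolding shift_def by (intro bexI[of _ y]) simp_all
next
  fix y d assume y: "y \<in> Z" and d: "d \<in> carrier \<Gamma>"
  have dc: "d \<otimes>\<^bsub>\<Gamma>\<^esub> c \<in> carrier \<Gamma>" using d c by (rule \<Gamma>.m_closed)
  obtain s where s: "s \<in> carrier \<Gamma>" "snd s = snd (d \<otimes>\<^bsub>\<Gamma>\<^esub> c)"
      "gclose m (fst (d \<otimes>\<^bsub>\<Gamma>\<^esub> c)) (fst s)" "occurs n x y s"
    using x y dc unfolding good_def by blast
  obtain t where t: "t \<in> carrier \<Gamma>" "t \<otimes>\<^bsub>\<Gamma>\<^esub> c = s" "snd t = snd d" "gclose m (fst d) (fst t)"
    using untranslate[OF s(1) d c s(2,3)] by blast
  then show "\<exists>s\<in>carrier \<Gamma>. snd s = snd d \<and> gclose m (fst d) (fst s) \<and> occurs n (shift c x) y s"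
    using occurs_shift[of n x y t c] s(4) c by blast
qed

section \<open>Coding of configurations by points of the Cantor space\<close>

definition code_set :: "(('a \<times> letter list) \<times> nat \<times> bool) set" where
  "code_set = carrier \<Gamma> \<times> UNIV"

lemma countable_code_set: "countable code_set"
  unfolding code_set_def using countable_\<Gamma> by auto

lemma infinite_code_set: "infinite code_set"
  unfolding code_set_def using infinite_\<Gamma> finite_cartesian_productD1 by blast

definition dec :: "point \<Rightarrow> 'a config" where
  "dec x = (\<lambda>a i. (x (to_nat_on code_set (a, i, False)), x (to_nat_on code_set (a, i, True))))"

definition enc :: "'a config \<Rightarrow> point" where
  "enc c = (\<lambda>k. case from_nat_into code_set k of (a, i, t) \<Rightarrow> if t then snd (c a i) else fst (c a i))"

lemma dec_enc: "a \<in> carrier \<Gamma> \<Longrightarrow> dec (enc c) a i = c a i"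
  unfolding dec_def enc_def using from_nat_into_to_nat_on[OF countable_code_set]
  by (simp add: code_set_def)

text \<open>Since \<open>code_set\<close> is countably infinite, every index \<open>k\<close> names
  a bit of a letter at some point of the group, so the values there determine the code.\<close>

lemma enc_eqI:
  assumes "\<And>a i t. from_nat_into code_set k = (a, i, t) \<Longrightarrow> a \<in> carrier \<Gamma> \<Longrightarrow> c a i = dec x a i"
  shows "enc c k = x k"
proof -
  obtain a i t' where k: "from_nat_into code_set k = (a, i, t')" using prod_cases3 by blast
  moreover have "(a, i, t') \<in> code_set"
    using k from_nat_into[of code_set k] infinite_code_set by force
  moreover have "to_nat_on code_set (from_nat_into code_set k) = k"
    using to_nat_on_from_nat_into_infinite[OF countable_code_set infinite_code_set] .
  ultimately show ?thesis using assms[of a i] unfolding enc_def dec_def code_set_def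
    by (cases t') auto
qed

lemma closedin_dec:
  assumes "finite B" "\<And>x x'. (\<And>b i. b \<in> B \<Longrightarrow> i < N \<Longrightarrow> x b i = x' b i) \<Longrightarrow> P x \<Longrightarrow> P x'"
  shows "closedin cantor {x. P (dec x)}" "openin cantor {x. P (dec x)}"
proof -
  define K where "K = to_nat_on code_set ` (B \<times> {..<N} \<times> UNIV)"
  have K: "finite K" unfolding K_def using assms(1) by simp
  have eq: "dec x b i = dec x' b i"
    if "\<And>k. k \<in> K \<Longrightarrow> x k = x' k" "b \<in> B" "i < N" for x x' b i
    using that unfolding dec_def K_def by simp
  show "openin cantor {x. P (dec x)}"
  proof (rule openin_finitely_determined[OF K])
    fix x x' assume "\<And>k. k \<in> K \<Longrightarrow> x k = x' k" "P (dec x)"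
    then show "P (dec x')" using assms(2)[of "dec x" "dec x'"] eq[of x x'] by blast
  qed
  have "openin cantor {x. \<not> P (dec x)}"
  proof (rule openin_finitely_determined[OF K])
    fix x x' assume "\<And>k. k \<in> K \<Longrightarrow> x k = x' k" "\<not> P (dec x)"
    then show "\<not> P (dec x')" using assms(2)[of "dec x'" "dec x"] eq[of x' x] by force
  qed
  moreover have "UNIV - {x. P (dec x)} = {x. \<not> P (dec x)}" by blast
  ultimately show "closedin cantor {x. P (dec x)}" unfolding closedin_def by simp
qed

lemma closedin_legal: "closedin cantor {x. legal (dec x)}"
proof -
  have "closedin cantor {x. layer i (\<lambda>a. dec x a i)}" for i
  proof (cases i)
    case 0
    have "closedin cantor {x. 2 \<le> card {s. dec x (fst a, cons_letter s (snd a)) 0 = inv_letter s}}" for a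
      by (rule closedin_dec(1)[of "(\<lambda>s. (fst a, cons_letter s (snd a))) ` UNIV" 1]) auto
    then have "closedin cantor (\<Inter>a\<in>carrier \<Gamma>. {x. 2 \<le> card {s. dec x (fst a, cons_letter s (snd a)) 0 = inv_letter s}})"
      using \<Gamma>.one_closed by (intro closedin_Inter) auto
    moreover have "(\<Inter>a\<in>carrier \<Gamma>. {x. 2 \<le> card {s. dec x (fst a, cons_letter s (snd a)) 0 = inv_letter s}})
        = {x. layer i (\<lambda>a. dec x a i)}" unfolding layer_def 0 by auto
    ultimately show ?thesis by simp
  next
    case (Suc j)
    show ?thesis
    proof (cases "elt j = \<one>\<^bsub>\<Gamma>\<^esub>")
      case True
      then show ?thesis using Suc closedin_topspace[of cantor] unfolding layer_def by simp
    next
      case False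
      have "closedin cantor {x. dec x (elt j \<otimes>\<^bsub>\<Gamma>\<^esub> a) i \<noteq> dec x a i}" for a
        by (rule closedin_dec(1)[of "{elt j \<otimes>\<^bsub>\<Gamma>\<^esub> a, a}" "Suc i"]) auto
      then have "closedin cantor (\<Inter>a\<in>carrier \<Gamma>. {x. dec x (elt j \<otimes>\<^bsub>\<Gamma>\<^esub> a) i \<noteq> dec x a i})"
        using \<Gamma>.one_closed by (intro closedin_Inter) auto
      moreover have "(\<Inter>a\<in>carrier \<Gamma>. {x. dec x (elt j \<otimes>\<^bsub>\<Gamma>\<^esub> a) i \<noteq> dec x a i})
          = {x. layer i (\<lambda>a. dec x a i)}" using False unfolding layer_def Suc by auto
      ultimately show ?thesis by simp
    qed
  qed
  then have "closedin cantor (\<Inter>i. {x. layer i (\<lambda>a. dec x a i)})" by (intro closedin_Inter) auto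
  moreover have "(\<Inter>i. {x. layer i (\<lambda>a. dec x a i)}) = {x. legal (dec x)}"
    unfolding legal_def by auto
  ultimately show ?thesis by simp
qed

lemma closedin_good: "closedin cantor {x. good n Z m (dec x)}"
proof -
  define P where "P d x \<longleftrightarrow> (\<exists>y\<in>Z. \<forall>b. close n \<one>\<^bsub>\<Gamma>\<^esub> b \<longrightarrow> (\<forall>i<n. x (b \<otimes>\<^bsub>\<Gamma>\<^esub> d) i = y b i))"
    for d and x :: "'a config"
  define Q where "Q y d x \<longleftrightarrow> (\<exists>s\<in>carrier \<Gamma>. snd s = snd d \<and> gclose m (fst d) (fst s) \<and> occurs n x y s)"
    for y d and x :: "'a config"
  have "closedin cantor {x. P d (dec x)}" for d
  proof (rule closedin_dec(1))
    show "finite ((\<lambda>b. b \<otimes>\<^bsub>\<Gamma>\<^esub> d) ` {b. close n \<one>\<^bsub>\<Gamma>\<^esub> b})" by (simp add: finite_close)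
    show "P d x'" if eq: "\<And>b i. b \<in> (\<lambda>b. b \<otimes>\<^bsub>\<Gamma>\<^esub> d) ` {b. close n \<one>\<^bsub>\<Gamma>\<^esub> b} \<Longrightarrow> i < n \<Longrightarrow> x b i = x' b i"
      and P: "P d x" for x x'
    proof -
      obtain y where y: "y \<in> Z" "\<forall>b. close n \<one>\<^bsub>\<Gamma>\<^esub> b \<longrightarrow> (\<forall>i<n. x (b \<otimes>\<^bsub>\<Gamma>\<^esub> d) i = y b i)"
        using P unfolding P_def by blast
      have "x' (b \<otimes>\<^bsub>\<Gamma>\<^esub> d) i = y b i" if "close n \<one>\<^bsub>\<Gamma>\<^esub> b" "i < n" for b i
        using eq[of "b \<otimes>\<^bsub>\<Gamma>\<^esub> d" i] y(2) that by simp
      then show ?thesis using y(1) unfolding P_def by blast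
    qed
  qed
  moreover have "closedin cantor {x. Q y d (dec x)}" if d: "d \<in> carrier \<Gamma>" for y d
  proof (rule closedin_dec(1))
    \<comment> \<open>The bound \<open>m\<close> confines the spot \<open>s\<close>, so the
      existential depends on one finite window around \<open>d\<close>. This is why recurrence
      within a bounded distance is a closed condition.\<close>
    show "finite {b. close (Suc (max m n)) d b}" by (rule finite_close)
    show "Q y d x'" if eq: "\<And>b i. b \<in> {b. close (Suc (max m n)) d b} \<Longrightarrow> i < n \<Longrightarrow> x b i = x' b i"
      and Q: "Q y d x" for x x'
    proof -
      obtain s where s: "s \<in> carrier \<Gamma>" "snd s = snd d" "gclose m (fst d) (fst s)" "occurs n x y s"
        using Q unfolding Q_def by blast
      have "close m d s" using s d unfolding close_def by (auto simp: near_refl carrier_\<Gamma>)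
      then have "close (Suc (max m n)) d b" if "close n s b" for b
        using close_trans'[OF _ that] by simp
      then have "occurs n x' y s" using eq by (intro occurs_cong[OF s(4)]) simp
      then show ?thesis using s(1-3) unfolding Q_def by blast
    qed
  qed
  moreover have non_empty: "carrier \<Gamma> \<noteq> {}" using \<Gamma>.one_closed by blast
  \<comment> \<open>If \<open>Z\<close> is empty, the second intersection runs over no sets and is
    the whole space; the factor \<open>UNIV\<close> and the case distinction take care of
    this.\<close>
  ultimately have "closedin cantor ((\<Inter>d\<in>carrier \<Gamma>. {x. P d (dec x)}) \<inter>
      (UNIV \<inter> (\<Inter>(y, d)\<in>Z \<times> carrier \<Gamma>. {x. Q y d (dec x)})))"
    using closedin_topspace[of cantor] non_empty by (cases "Z = {}") (auto intro!: closedin_Int closedin_Inter)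
  moreover have "((\<Inter>d\<in>carrier \<Gamma>. {x. P d (dec x)}) \<inter>
      (UNIV \<inter> (\<Inter>(y, d)\<in>Z \<times> carrier \<Gamma>. {x. Q y d (dec x)}))) = {x. good n Z m (dec x)}"
    unfolding good_def P_def[symmetric] Q_def[symmetric] by auto
  ultimately show ?thesis by simp
qed

lemma enc_cong:
  assumes "\<And>a i. a \<in> carrier \<Gamma> \<Longrightarrow> c a i = c' a i" shows "enc c = enc c'"
proof
  fix k show "enc c k = enc c' k"
    by (rule enc_eqI) (simp add: assms dec_enc)
qed

lemma enc_dec: "enc (dec x) = x"
proof
  fix k show "enc (dec x) k = x k" by (rule enc_eqI) simp
qed

definition act :: "'a \<times> letter list \<Rightarrow> point \<Rightarrow> point" where
  "act c x = enc (shift c (dec x))"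

lemma dec_act: "a \<in> carrier \<Gamma> \<Longrightarrow> dec (act c x) a i = dec x (a \<otimes>\<^bsub>\<Gamma>\<^esub> c) i"
  unfolding act_def by (simp add: dec_enc shift_def)

lemma act_one: "act \<one>\<^bsub>\<Gamma>\<^esub> x = x"
proof -
  have "act \<one>\<^bsub>\<Gamma>\<^esub> x = enc (dec x)" unfolding act_def
    by (rule enc_cong) (simp add: shift_def)
  then show ?thesis by (simp add: enc_dec)
qed

lemma act_mult:
  assumes "c \<in> carrier \<Gamma>" "d \<in> carrier \<Gamma>" shows "act (c \<otimes>\<^bsub>\<Gamma>\<^esub> d) x = act c (act d x)"
  unfolding act_def
proof (rule enc_cong)
  fix a i assume a: "a \<in> carrier \<Gamma>"
  then have "a \<otimes>\<^bsub>\<Gamma>\<^esub> c \<in> carrier \<Gamma>" using assms(1) by (rule \<Gamma>.m_closed)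
  then show "shift (c \<otimes>\<^bsub>\<Gamma>\<^esub> d) (dec x) a i = shift c (dec (enc (shift d (dec x)))) a i"
    using \<Gamma>.m_assoc[OF a assms] unfolding shift_def by (simp add: dec_enc)
qed

lemma continuous_act: "continuous_map cantor cantor (act c)"
proof -
  have "continuous_map cantor (discrete_topology UNIV) (\<lambda>x. act c x k)" for k
  proof -
  obtain a i t where k: "from_nat_into code_set k = (a, i, t)" using prod_cases3 by blast
  have ac: "a \<in> carrier \<Gamma>" using k from_nat_into[of code_set k] infinite_code_set unfolding code_set_def by force
  have eq: "act c x k = (if t then snd (dec x (a \<otimes>\<^bsub>\<Gamma>\<^esub> c) i) else fst (dec x (a \<otimes>\<^bsub>\<Gamma>\<^esub> c) i))" for x
    unfolding act_def enc_def k shift_def by simp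
  show ?thesis
    unfolding continuous_map_def
  proof (intro conjI allI impI)
    fix U assume "openin (discrete_topology UNIV) (U :: bool set)"
    have "openin cantor {x. (if t then snd (dec x (a \<otimes>\<^bsub>\<Gamma>\<^esub> c) i) else fst (dec x (a \<otimes>\<^bsub>\<Gamma>\<^esub> c) i)) \<in> U}"
    proof (rule closedin_dec(2)[of "{a \<otimes>\<^bsub>\<Gamma>\<^esub> c}" "Suc i"])
      fix x x' :: "'a config"
      assume e: "\<And>b j. b \<in> {a \<otimes>\<^bsub>\<Gamma>\<^esub> c} \<Longrightarrow> j < Suc i \<Longrightarrow> x b j = x' b j"
      have "x (a \<otimes>\<^bsub>\<Gamma>\<^esub> c) i = x' (a \<otimes>\<^bsub>\<Gamma>\<^esub> c) i" by (rule e) simp_all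
      moreover assume "(if t then snd (x (a \<otimes>\<^bsub>\<Gamma>\<^esub> c) i) else fst (x (a \<otimes>\<^bsub>\<Gamma>\<^esub> c) i)) \<in> U"
      ultimately show "(if t then snd (x' (a \<otimes>\<^bsub>\<Gamma>\<^esub> c) i) else fst (x' (a \<otimes>\<^bsub>\<Gamma>\<^esub> c) i)) \<in> U"
        by (cases t) simp_all
    qed simp
    then show "openin cantor {x \<in> topspace cantor. act c x k \<in> U}" by (simp add: eq)
  qed simp
  qed
  then have "continuous_map cantor (product_topology (\<lambda>_. discrete_topology UNIV) UNIV) (act c)"
    by (simp add: continuous_map_componentwise_UNIV)
  then show ?thesis by (simp only: cantor_def[symmetric])
qed

end

section \<open>The flow on the limit set\<close>

locale limit_space = countably_infinite_group G for G :: "('a, 'b) monoid_scheme" (structure) +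
  fixes Z :: "nat \<Rightarrow> 'a config set" and m :: "nat \<Rightarrow> nat"
  assumes stage_Z: "\<And>n. stage n (Z n)" and Z_mono: "\<And>n. Z (Suc n) \<subseteq> Z n"
    and Z_occurs: "\<And>n z y d. z \<in> Z (Suc n) \<Longrightarrow> y \<in> Z n \<Longrightarrow> d \<in> carrier (G \<times>\<times> F2) \<Longrightarrow>
      \<exists>s\<in>carrier (G \<times>\<times> F2). snd s = snd d \<and> gclose (m n) (fst d) (fst s) \<and> occurs n z y s"
begin

definition limit_set where
  "limit_set = {x. legal (dec x) \<and> (\<forall>n. good n (Z n) (m n) (dec x))}"

definition X :: "point topology" where
  "X = subtopology cantor limit_set"

definition \<phi> where
  "\<phi> c = restrict (act c) limit_set"

lemma topspace_X [simp]: "topspace X = limit_set"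
  unfolding X_def by simp

lemma Z_good: assumes z: "z \<in> Z (Suc n)" shows "good n (Z n) (m n) z"
  unfolding good_def
proof (intro conjI ballI)
  fix d assume d: "d \<in> carrier \<Gamma>"
  have "shift d z \<in> Z n" using stage_Z[of n] Z_mono z d unfolding stage_def by blast
  then show "\<exists>y\<in>Z n. \<forall>b. close n \<one>\<^bsub>\<Gamma>\<^esub> b \<longrightarrow> (\<forall>i<n. z (b \<otimes>\<^bsub>\<Gamma>\<^esub> d) i = y b i)"
    by (rule bexI[rotated]) (simp add: shift_def)
next
  fix y d assume "y \<in> Z n" "d \<in> carrier \<Gamma>"
  with Z_occurs[OF z] show "\<exists>s\<in>carrier \<Gamma>. snd s = snd d \<and> gclose (m n) (fst d) (fst s) \<and> occurs n z y s" .
qed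

text \<open>Nested closed sets in a compact space: the conditions of index at most \<open>N\<close>
  are met by the code of any member of \<open>Z (Suc N)\<close>, which lies in
  \<open>Z (Suc n)\<close> for every \<open>n \<le> N\<close>.\<close>

lemma limit_set_nonempty: "limit_set \<noteq> {}" and closedin_limit_set: "closedin cantor limit_set"
proof -
  define C where "C N = {x. legal (dec x)} \<inter> (\<Inter>n\<in>{..N}. {x. good n (Z n) (m n) (dec x)})" for N
  have cl: "closedin cantor (C N)" for N
    unfolding C_def by (intro closedin_Int closedin_legal closedin_Inter) (auto intro: closedin_good)
  have ne: "C N \<noteq> {}" for N
  proof -
    obtain z where z: "z \<in> Z (Suc N)" using stage_nonempty[OF stage_Z] by blast
    have "legal (dec (enc z))"
      using stage_Z[of "Suc N"] z dec_enc legal_cong[of z "dec (enc z)"] unfolding stage_def by blast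
    moreover have "good n (Z n) (m n) (dec (enc z))" if "n \<le> N" for n
    proof -
      have "Z (Suc N) \<subseteq> Z (Suc n)" using lift_Suc_antimono_le[of Z "Suc n" "Suc N"] Z_mono that by simp
      then show ?thesis using Z_good good_cong[of n "Z n" "m n" z "dec (enc z)"] z dec_enc by blast
    qed
    ultimately show ?thesis unfolding C_def by auto
  qed
  have "C (Suc N) \<subseteq> C N" for N unfolding C_def by auto
  then have "decseq C" by (rule decseq_SucI)
  then have "(\<Inter>N. C N) \<noteq> {}"
    using compact_space_imp_nest[of cantor C] compact_cantor cl ne by blast
  moreover have eq: "(\<Inter>N. C N) = limit_set" unfolding C_def limit_set_def by auto
  ultimately show "limit_set \<noteq> {}" by simp
  show "closedin cantor limit_set" unfolding eq[symmetric] by (rule closedin_Inter) (use cl in auto)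
qed

lemma act_limit_set: assumes "c \<in> carrier \<Gamma>" "x \<in> limit_set" shows "act c x \<in> limit_set"
proof -
  have "legal (shift c (dec x))" "\<And>n. good n (Z n) (m n) (shift c (dec x))"
    using assms legal_shift good_shift unfolding limit_set_def by blast+
  then show ?thesis unfolding limit_set_def act_def
    using legal_cong[of "shift c (dec x)"] good_cong[of _ _ _ "shift c (dec x)"] dec_enc by auto
qed

lemma group_hom_\<phi>: "group_hom \<Gamma> (BijGroup limit_set) \<phi>"
proof -
  have bij: "\<phi> c \<in> Bij limit_set" if c: "c \<in> carrier \<Gamma>" for c
  proof -
    have ci: "inv\<^bsub>\<Gamma>\<^esub> c \<in> carrier \<Gamma>" using c by (rule \<Gamma>.inv_closed)
    have "act (inv\<^bsub>\<Gamma>\<^esub> c) (act c x) = x" "act c (act (inv\<^bsub>\<Gamma>\<^esub> c) x) = x" for x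
      using act_mult[OF c ci, of x] act_mult[OF ci c, of x] c by (simp_all add: act_one)
    then have "bij_betw (act c) limit_set limit_set"
      using act_limit_set[OF c] act_limit_set[OF ci] by (intro bij_betw_byWitness[of _ "act (inv\<^bsub>\<Gamma>\<^esub> c)"]) auto
    then have "bij_betw (\<phi> c) limit_set limit_set" unfolding \<phi>_def by simp
    then show ?thesis unfolding Bij_def \<phi>_def by simp
  qed
  have "\<phi> (c \<otimes>\<^bsub>\<Gamma>\<^esub> d) = \<phi> c \<otimes>\<^bsub>BijGroup limit_set\<^esub> \<phi> d" if "c \<in> carrier \<Gamma>" "d \<in> carrier \<Gamma>" for c d
  proof
    fix x show "\<phi> (c \<otimes>\<^bsub>\<Gamma>\<^esub> d) x = (\<phi> c \<otimes>\<^bsub>BijGroup limit_set\<^esub> \<phi> d) x"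
      using that bij[OF that(1)] bij[OF that(2)] act_mult[OF that, of x] act_limit_set[OF that(2), of x]
      by (simp add: BijGroup_def \<phi>_def compose_def)
  qed
  then have "\<phi> \<in> hom \<Gamma> (BijGroup limit_set)" using bij by (intro homI) (auto simp: BijGroup_def)
  then show ?thesis using group_\<Gamma> group_BijGroup by (simp add: group_hom_def group_hom_axioms_def)
qed

lemma flow_\<Gamma>: "is_flow \<Gamma> X \<phi>"
proof -
  have "continuous_map X X (\<phi> c)" if "c \<in> carrier \<Gamma>" for c
  proof -
    have "continuous_map X X (act c)"
      unfolding X_def using act_limit_set[OF that]
      by (auto simp: continuous_map_in_subtopology intro: continuous_map_from_subtopology continuous_act)
    then show ?thesis by (rule continuous_map_eq) (simp add: \<phi>_def)
  qed
  moreover have "compact_space X" unfolding X_def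
    using closedin_compact_space[OF compact_cantor closedin_limit_set] compact_space_subtopology by blast
  moreover have "Hausdorff_space X" unfolding X_def by (rule Hausdorff_space_subtopology[OF Hausdorff_cantor])
  ultimately show ?thesis unfolding is_flow_def using limit_set_nonempty group_hom_\<phi>
    by (simp add: group_action_def)
qed

lemma free_\<Gamma>: "free_flow \<Gamma> X \<phi>"
  unfolding free_flow_def
proof (intro conjI flow_\<Gamma> ballI notI)
  fix c x assume c: "c \<in> carrier \<Gamma> - {\<one>\<^bsub>\<Gamma>\<^esub>}" and x: "x \<in> topspace X" and eq: "\<phi> c x = x"
  obtain j where j: "elt j = c" using elt_surj c by blast
  have "act c x = x" using eq x unfolding \<phi>_def by simp
  then have "dec x \<one>\<^bsub>\<Gamma>\<^esub> (Suc j) = dec x (\<one>\<^bsub>\<Gamma>\<^esub> \<otimes>\<^bsub>\<Gamma>\<^esub> c) (Suc j)"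
    using dec_act[OF \<Gamma>.one_closed, of c x "Suc j"] by simp
  moreover have "layer (Suc j) (\<lambda>a. dec x a (Suc j))" using x unfolding topspace_X limit_set_def legal_def by blast
  then have "\<forall>a\<in>carrier \<Gamma>. dec x (c \<otimes>\<^bsub>\<Gamma>\<^esub> a) (Suc j) \<noteq> dec x a (Suc j)"
    using c j unfolding layer_def by simp
  then have "dec x (c \<otimes>\<^bsub>\<Gamma>\<^esub> \<one>\<^bsub>\<Gamma>\<^esub>) (Suc j) \<noteq> dec x \<one>\<^bsub>\<Gamma>\<^esub> (Suc j)"
    using \<Gamma>.one_closed by blast
  ultimately show False using c by simp
qed

text \<open>The window of \<open>y\<close> is that of some \<open>y0\<close> in \<open>Z n\<close>,
  and \<open>x\<close>, being good, shows \<open>y0\<close> at a spot with the tree coordinate of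
  the unit. Translation by this spot, an element of \<open>G\<close>, brings the window to the
  unit.\<close>

lemma orbit_near:
  assumes x: "x \<in> limit_set" and y: "y \<in> limit_set"
  shows "\<exists>g\<in>carrier G. \<forall>b. close n \<one>\<^bsub>\<Gamma>\<^esub> b \<longrightarrow> (\<forall>i<n. dec (act (g, []) x) b i = dec y b i)"
proof -
  have "good n (Z n) (m n) (dec y)" "good n (Z n) (m n) (dec x)" using x y unfolding limit_set_def by blast+
  note g = this[unfolded good_def]
  obtain y0 where y0: "y0 \<in> Z n"
    "\<forall>b. close n \<one>\<^bsub>\<Gamma>\<^esub> b \<longrightarrow> (\<forall>i<n. dec y (b \<otimes>\<^bsub>\<Gamma>\<^esub> \<one>\<^bsub>\<Gamma>\<^esub>) i = y0 b i)"
    using bspec[OF conjunct1[OF g(1)] \<Gamma>.one_closed] by blast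
  have "\<exists>s\<in>carrier \<Gamma>. snd s = snd \<one>\<^bsub>\<Gamma>\<^esub> \<and> gclose (m n) (fst \<one>\<^bsub>\<Gamma>\<^esub>) (fst s) \<and> occurs n (dec x) y0 s"
    using bspec[OF bspec[OF conjunct2[OF g(2)] y0(1)] \<Gamma>.one_closed] .
  then obtain s where s: "s \<in> carrier \<Gamma>" "snd s = []" "occurs n (dec x) y0 s"
    by (auto simp: one_DirProd)
  have "dec (act s x) b i = dec y b i" if b: "close n \<one>\<^bsub>\<Gamma>\<^esub> b" "i < n" for b i
  proof -
    have bc: "b \<in> carrier \<Gamma>" using close_carrier b by blast
    have "close n s (b \<otimes>\<^bsub>\<Gamma>\<^esub> s)" using close_mult[OF b(1) s(1)] s(1) by simp
    then have "dec x (b \<otimes>\<^bsub>\<Gamma>\<^esub> s) i = y0 ((b \<otimes>\<^bsub>\<Gamma>\<^esub> s) \<otimes>\<^bsub>\<Gamma>\<^esub> inv\<^bsub>\<Gamma>\<^esub> s) i"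
      using s(3) b(2) unfolding occurs_def shift_def by blast
    also have "(b \<otimes>\<^bsub>\<Gamma>\<^esub> s) \<otimes>\<^bsub>\<Gamma>\<^esub> inv\<^bsub>\<Gamma>\<^esub> s = b" using bc s(1) by (simp add: \<Gamma>.m_assoc)
    also have "y0 b i = dec y b i" using y0(2)[rule_format, OF b] bc by simp
    finally show ?thesis using dec_act[OF bc] by simp
  qed
  moreover have "s = (fst s, [])" "fst s \<in> carrier G" using s by (auto simp: carrier_\<Gamma> prod_eq_iff)
  ultimately show ?thesis by metis
qed

lemma dense_orbit:
  assumes x: "x \<in> limit_set" and U: "openin X U" "y \<in> U"
  shows "\<exists>g\<in>carrier G. act (g, []) x \<in> U"
proof -
  obtain W where W: "openin cantor W" "U = W \<inter> limit_set" using U(1) unfolding X_def openin_subtopology by auto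
  then obtain K where K: "finite K" "\<And>x. (\<And>k. k \<in> K \<Longrightarrow> x k = y k) \<Longrightarrow> x \<in> W"
    using cylinder_nbhd[OF W(1), of y] U(2) by auto
  define B where "B = (fst \<circ> from_nat_into code_set) ` K"
  define I where "I = (fst \<circ> snd \<circ> from_nat_into code_set) ` K"
  have "from_nat_into code_set k \<in> code_set" for k
    using from_nat_into[of code_set k] infinite_code_set by force
  then have "B \<subseteq> carrier \<Gamma>" unfolding B_def code_set_def by (auto simp: mem_Times_iff)
  moreover have "finite B" "finite I" unfolding B_def I_def using K(1) by simp_all
  ultimately obtain j where j: "\<forall>b\<in>B. close j \<one>\<^bsub>\<Gamma>\<^esub> b"
    using uniform_close_exhausts[of B "\<one>\<^bsub>\<Gamma>\<^esub>"] \<Gamma>.one_closed by blast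
  obtain N where N: "\<forall>i\<in>I. i < N" using \<open>finite I\<close> finite_nat_set_iff_bounded by blast
  \<comment> \<open>One index governs both the radius of a window and the number of layers seen in
    it, hence the maximum.\<close>
  obtain g where g: "g \<in> carrier G"
    "\<forall>b. close (max j N) \<one>\<^bsub>\<Gamma>\<^esub> b \<longrightarrow> (\<forall>i<max j N. dec (act (g, []) x) b i = dec y b i)"
    using orbit_near[OF x, of y "max j N"] U(2) W(2) by blast
  have "act (g, []) x k = y k" if k: "k \<in> K" for k
  proof -
    have "enc (dec (act (g, []) x)) k = y k"
    proof (rule enc_eqI)
      fix a i t assume a: "from_nat_into code_set k = (a, i, t)"
      then have "a \<in> B" "i \<in> I" using k unfolding B_def I_def by force+
      then have "close j \<one>\<^bsub>\<Gamma>\<^esub> a" "i < max j N" using j N by (auto simp: less_max_iff_disj)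
      moreover from this(1) have "close (max j N) \<one>\<^bsub>\<Gamma>\<^esub> a" by (rule close_mono) simp
      ultimately show "dec (act (g, []) x) a i = dec y a i" using g(2) by blast
    qed
    then show ?thesis by (simp add: enc_dec)
  qed
  then have "act (g, []) x \<in> W" by (rule K(2))
  moreover have "(g, []) \<in> carrier \<Gamma>" using g(1) by (simp add: carrier_\<Gamma>)
  then have "act (g, []) x \<in> limit_set" using act_limit_set x by blast
  ultimately show ?thesis using g(1) W(2) by blast
qed

section \<open>Restriction to \<open>G\<close> and minimality\<close>

lemma group_action_restrict_fst: "group_action G limit_set (restrict_fst F2 \<phi>)"
proof -
  interpret h: group_hom \<Gamma> "BijGroup limit_set" \<phi> by (rule group_hom_\<phi>)
  have c: "(g, []) \<in> carrier \<Gamma>" if "g \<in> carrier G" for g using that by (simp add: carrier_\<Gamma>)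
  have "restrict_fst F2 \<phi> \<in> hom G (BijGroup limit_set)"
  proof (rule homI)
    fix g g' assume g: "g \<in> carrier G" "g' \<in> carrier G"
    show "restrict_fst F2 \<phi> g \<in> carrier (BijGroup limit_set)"
      using h.hom_closed[OF c[OF g(1)]] by (simp add: restrict_fst_def)
    show "restrict_fst F2 \<phi> (g \<otimes> g') = restrict_fst F2 \<phi> g \<otimes>\<^bsub>BijGroup limit_set\<^esub> restrict_fst F2 \<phi> g'"
      using h.hom_mult[OF c[OF g(1)] c[OF g(2)]] by (simp add: restrict_fst_def mult_\<Gamma>)
  qed
  then show ?thesis using is_group group_BijGroup
    by (simp add: group_action_def group_hom_def group_hom_axioms_def)
qed

lemma flow_G: "is_flow G X (restrict_fst F2 \<phi>)"
  using flow_\<Gamma> group_action_restrict_fst unfolding is_flow_def by (simp add: restrict_fst_def carrier_\<Gamma>)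

lemma minimal_G: "minimal_flow G X (restrict_fst F2 \<phi>)"
  unfolding minimal_flow_def
proof (intro conjI flow_G ballI)
  fix x assume x: "x \<in> topspace X"
  have "y \<in> X closure_of orbit G (restrict_fst F2 \<phi>) x" if y: "y \<in> topspace X" for y
    unfolding in_closure_of
  proof (intro conjI y allI impI)
    fix U assume U: "y \<in> U \<and> openin X U"
    then obtain g where g: "g \<in> carrier G" "act (g, []) x \<in> U"
      using dense_orbit[of x U y] x by auto
    then have "act (g, []) x \<in> orbit G (restrict_fst F2 \<phi>) x"
      using x unfolding orbit_def restrict_fst_def \<phi>_def by auto
    then show "\<exists>z. z \<in> orbit G (restrict_fst F2 \<phi>) x \<and> z \<in> U" using g(2) by blast
  qed
  then show "X closure_of orbit G (restrict_fst F2 \<phi>) x = topspace X"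
    by (intro subset_antisym closure_of_subset_topspace subsetI)
qed

text \<open>
  Mass transport: the expected number of letters pointing to the unit is at least 2, but by
  invariance it equals the expected number of pointers leaving the unit, which is 1.
\<close>

lemma no_invariant_measure:
  assumes \<mu>: "\<mu> \<in> prob_measures X" and inv: "invariant_measure (restrict_snd G \<phi> ` carrier F2) \<mu>"
  shows False
proof -
  interpret prob_space \<mu> using \<mu> unfolding prob_measures_def by simp
  have sp: "space \<mu> = limit_set" and se: "sets \<mu> = sigma_sets limit_set {U. openin X U}"
    using \<mu> unfolding prob_measures_def by auto
  have open_sets: "U \<in> sets \<mu>" if "openin X U" for U
    using that unfolding se by (simp add: sigma_sets.Basic)
  \<comment> \<open>Pointers leaving the unit are recorded by \<open>S\<close>, pointers arriving at
    it by \<open>C\<close>: each point of the space lies in exactly one \<open>S s\<close> but in at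
    least two of the \<open>C s\<close>.\<close>
  define S where "S s = {x \<in> limit_set. dec x (\<one>, []) 0 = s}" for s
  define C where "C s = {x \<in> limit_set. dec x (\<one>, [s]) 0 = inv_letter s}" for s
  have unit: "(\<one>, []) \<in> carrier \<Gamma>" by (simp add: carrier_\<Gamma>)
  have S_sets: "S s \<in> events" for s
  proof (rule open_sets)
    have "openin cantor {x. dec x (\<one>, []) 0 = s}"
      by (rule closedin_dec(2)[of "{(\<one>, [])}" 1]) auto
    then show "openin X (S s)" unfolding X_def openin_subtopology S_def by blast
  qed
  have C_sets: "C s \<in> events" for s
  proof (rule open_sets)
    have "openin cantor {x. dec x (\<one>, [s]) 0 = inv_letter s}"
      by (rule closedin_dec(2)[of "{(\<one>, [s])}" 1]) auto
    then show "openin X (C s)" unfolding X_def openin_subtopology C_def by blast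
  qed
  \<comment> \<open>Translation by \<open>(\<one>, [s])\<close> moves the neighbour
    \<open>[s]\<close> to the unit, so \<open>C s\<close> is the preimage of
    \<open>S (inv_letter s)\<close>.\<close>
  have C_S: "prob (C s) = prob (S (inv_letter s))" for s
  proof -
    have c: "(\<one>, [s]) \<in> carrier \<Gamma>" by (simp add: carrier_\<Gamma>)
    let ?f = "\<phi> (\<one>, [s])"
    have f: "?f \<in> measurable \<mu> \<mu>"
    proof (rule measurable_sigma_sets[OF se])
      show "{U. openin X U} \<subseteq> Pow limit_set" using openin_subset[of X] by auto
      show "?f \<in> space \<mu> \<rightarrow> limit_set" unfolding sp \<phi>_def using act_limit_set[OF c] by auto
      fix U assume "U \<in> {U. openin X U}"
      moreover have "continuous_map X X ?f" using flow_\<Gamma> c unfolding is_flow_def by blast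
      ultimately have "openin X {x \<in> topspace X. ?f x \<in> U}" unfolding continuous_map_def by blast
      moreover have "?f -` U \<inter> space \<mu> = {x \<in> topspace X. ?f x \<in> U}" unfolding sp by auto
      ultimately show "?f -` U \<inter> space \<mu> \<in> events" using open_sets by simp
    qed
    have "?f \<in> restrict_snd G \<phi> ` carrier F2" unfolding restrict_snd_def by auto
    then have "distr \<mu> \<mu> ?f = \<mu>" using inv unfolding invariant_measure_def by blast
    then have "prob (S (inv_letter s)) = measure (distr \<mu> \<mu> ?f) (S (inv_letter s))" by simp
    also have "\<dots> = prob (?f -` S (inv_letter s) \<inter> space \<mu>)"
      by (rule measure_distr[OF f S_sets])
    also have "?f -` S (inv_letter s) \<inter> space \<mu> = C s"
      using act_limit_set[OF c] dec_act[OF unit, of "(\<one>, [s])"]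
      unfolding sp S_def C_def \<phi>_def by (auto simp: mult_\<Gamma>)
    finally show ?thesis by simp
  qed
  have "(\<Sum>s\<in>UNIV. prob (S s)) = prob (\<Union>s\<in>UNIV. S s)"
    by (rule finite_measure_finite_Union[symmetric]) (use S_sets in \<open>auto simp: disjoint_family_on_def S_def\<close>)
  also have "(\<Union>s\<in>UNIV. S s) = space \<mu>" unfolding sp S_def by blast
  finally have sum_S: "(\<Sum>s\<in>UNIV. prob (S s)) = 1" by (simp add: prob_space)
  have "bij inv_letter" by (rule involuntory_imp_bij) simp
  then have "(\<Sum>s\<in>UNIV. prob (S (inv_letter s))) = 1"
    using sum.reindex_bij_betw[of inv_letter UNIV UNIV "\<lambda>s. prob (S s)"] sum_S by simp
  then have sum_C: "(\<Sum>s\<in>UNIV. prob (C s)) = 1" by (simp add: C_S)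
  have two: "2 \<le> (\<Sum>s\<in>UNIV. indicator (C s) x :: real)" if x: "x \<in> space \<mu>" for x
  proof -
    have "layer 0 (\<lambda>a. dec x a 0)" using x unfolding sp limit_set_def legal_def by blast
    then have "2 \<le> card {s. dec x (\<one>, [s]) 0 = inv_letter s}" using unit unfolding layer_def by fastforce
    also have "{s. dec x (\<one>, [s]) 0 = inv_letter s} = {s. x \<in> C s}" using x unfolding sp C_def by simp
    finally have "2 \<le> real (card {s. x \<in> C s})" by simp
    also have "\<dots> = (\<Sum>s\<in>UNIV. indicator (C s) x)" by (simp add: indicator_def sum.If_cases)
    finally show ?thesis .
  qed
  have int: "integrable \<mu> (\<lambda>x. indicator (C s) x :: real)" for s
    using C_sets by (simp add: integrable_indicator_iff emeasure_eq_measure)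
  have "2 = expectation (\<lambda>x. 2 :: real)" by (simp add: prob_space)
  also have "\<dots> \<le> expectation (\<lambda>x. \<Sum>s\<in>UNIV. indicator (C s) x)"
    by (rule integral_mono) (use int two in auto)
  also have "\<dots> = (\<Sum>s\<in>UNIV. prob (C s))"
    using int C_sets sets.sets_into_space by (subst Bochner_Integration.integral_sum) (auto simp: Int_absorb2)
  finally show False using sum_C by simp
qed

end

text \<open>The two factors commute, so elements of \<open>F2\<close> act as automorphisms of the
  \<open>G\<close>-flow; a characteristic measure would therefore be
  \<open>F2\<close>-invariant.\<close>

lemma restrict_snd_flow_Aut:
  fixes G :: "('g, 'm) monoid_scheme"
  assumes G: "group G" and fl: "is_flow (G \<times>\<times> F2) X \<phi>"
  shows "restrict_snd G \<phi> ` carrier F2 \<subseteq> flow_Aut G X (restrict_fst F2 \<phi>)"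
proof
  interpret G: group G by (rule G)
  interpret H: group F2 by (rule group_F2)
  interpret A: group_action "G \<times>\<times> F2" "topspace X" \<phi> using fl unfolding is_flow_def by blast
  fix f assume "f \<in> restrict_snd G \<phi> ` carrier F2"
  then obtain h where h: "h \<in> carrier F2" "f = \<phi> (\<one>\<^bsub>G\<^esub>, h)" unfolding restrict_snd_def by blast
  have c: "(\<one>\<^bsub>G\<^esub>, h) \<in> carrier (G \<times>\<times> F2)" "(\<one>\<^bsub>G\<^esub>, inv\<^bsub>F2\<^esub> h) \<in> carrier (G \<times>\<times> F2)"
    "(\<one>\<^bsub>G\<^esub>, \<one>\<^bsub>F2\<^esub>) \<in> carrier (G \<times>\<times> F2)"
    using h(1) by simp_all
  have id: "\<phi> (\<one>\<^bsub>G\<^esub>, \<one>\<^bsub>F2\<^esub>) x = x" if "x \<in> topspace X" for x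
    using A.id_eq_one that by (metis one_DirProd restrict_apply')
  have "homeomorphic_maps X X f (\<phi> (\<one>\<^bsub>G\<^esub>, inv\<^bsub>F2\<^esub> h))"
    unfolding homeomorphic_maps_def h(2)
  proof (intro conjI ballI)
    show "continuous_map X X (\<phi> (\<one>\<^bsub>G\<^esub>, h))" "continuous_map X X (\<phi> (\<one>\<^bsub>G\<^esub>, inv\<^bsub>F2\<^esub> h))"
      using fl c unfolding is_flow_def by blast+
    fix x assume x: "x \<in> topspace X"
    show "\<phi> (\<one>\<^bsub>G\<^esub>, inv\<^bsub>F2\<^esub> h) (\<phi> (\<one>\<^bsub>G\<^esub>, h) x) = x"
      using A.composition_rule[OF x c(2,1)] id[OF x] h(1) by simp
    show "\<phi> (\<one>\<^bsub>G\<^esub>, h) (\<phi> (\<one>\<^bsub>G\<^esub>, inv\<^bsub>F2\<^esub> h) x) = x"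
      using A.composition_rule[OF x c(1,2)] id[OF x] h(1) by simp
  qed
  then have "homeomorphic_map X X f" by (rule homeomorphic_maps_imp_map)
  moreover have "f (restrict_fst F2 \<phi> g x) = restrict_fst F2 \<phi> g (f x)"
    if g: "g \<in> carrier G" and x: "x \<in> topspace X" for g x
  proof -
    have gc: "(g, \<one>\<^bsub>F2\<^esub>) \<in> carrier (G \<times>\<times> F2)" using g by simp
    show ?thesis using A.composition_rule[OF x c(1) gc] A.composition_rule[OF x gc c(1)] g h
      by (simp add: restrict_fst_def)
  qed
  moreover have "f \<in> Bij (topspace X)" using A.bij_prop0[OF c(1)] h(2) by simp
  ultimately show "f \<in> flow_Aut G X (restrict_fst F2 \<phi>)" unfolding flow_Aut_def by blast
qed

theorem theorem1:
  fixes G :: "('g, 'm) monoid_scheme"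
  assumes "group G" and "countable (carrier G)" and "infinite (carrier G)"
  shows "\<exists>(X :: point topology) \<phi>.
    (free_flow (G \<times>\<times> F2) X \<phi> \<and>
     minimal_flow G X (restrict_fst F2 \<phi>) \<and>
     (\<nexists>\<mu>. \<mu> \<in> prob_measures X \<and>
          invariant_measure (restrict_snd G \<phi> ` carrier F2) \<mu>)) \<and>
    (free_flow G X (restrict_fst F2 \<phi>) \<and>
     minimal_flow G X (restrict_fst F2 \<phi>) \<and>
     (\<nexists>\<mu>. characteristic_measure G X (restrict_fst F2 \<phi>) \<mu>))"
proof -
  interpret countably_infinite_group G
    using assms by (simp add: countably_infinite_group_def countably_infinite_group_axioms_def)
  obtain Z m where "\<And>n. stage n (Z n)" "\<And>n. Z (Suc n) \<subseteq> Z n"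
    "\<And>n z y d. z \<in> Z (Suc n) \<Longrightarrow> y \<in> Z n \<Longrightarrow> d \<in> carrier (G \<times>\<times> F2) \<Longrightarrow>
      \<exists>s\<in>carrier (G \<times>\<times> F2). snd s = snd d \<and> gclose (m n) (fst d) (fst s) \<and> occurs n z y s"
    using stage_sequence by blast
  then interpret limit_space G Z m by unfold_locales
  have "free_flow G X (restrict_fst F2 \<phi>)"
    unfolding free_flow_def
  proof (intro conjI flow_G ballI)
    fix g x assume "g \<in> carrier G - {\<one>\<^bsub>G\<^esub>}" "x \<in> topspace X"
    then show "restrict_fst F2 \<phi> g x \<noteq> x"
      using free_\<Gamma> unfolding free_flow_def restrict_fst_def by (auto simp: carrier_\<Gamma> one_DirProd)
  qed
  moreover have "\<not> characteristic_measure G X (restrict_fst F2 \<phi>) \<mu>" for \<mu>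
    using restrict_snd_flow_Aut[OF assms(1) flow_\<Gamma>] no_invariant_measure[of \<mu>]
    unfolding characteristic_measure_def invariant_measure_def by blast
  ultimately show ?thesis using free_\<Gamma> minimal_G no_invariant_measure by blast
qed

end
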